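(* There is a randomized polynomial-time algorithm for the Nash social welfare maximization problem (with additive valuations) that, with high probability, returns an allocation whose Nash social welfare is at least a $1/e$ fraction of the optimum Nash social welfare.
   Context: Nash social welfare (NSW) maximization problem: there are $m$ indivisible items and $n$ agents; agent $i$ has a non-negative value $v_{i,j}$ for item $j$. An allocation is a vector ${\bf x}\in\{0,1\}^{n\times m}$ such that for each item $j$ exactly one $x_{i,j}$ equals $1$. The value of agent $i$ under ${\bf x}$ is $v_i({\bf x})=\sum_{j=1}^m x_{i,j}v_{i,j}$. The Nash social welfare of ${\bf x}$ is $\left(\prod_{i=1}^n v_i({\bf x})\right)^{1/n}$, and the goal is to find an allocation maximizing it. *)

theory Defs
  imports
    "HOL-Probability.Probability"
    "HOL-Computational_Algebra.Polynomial"
    "HOL-Library.Log_Nat"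
begin

text \<open>Items are the numbers below \<open>m\<close>, agents the numbers below \<open>n\<close>. Since the statement is about
  algorithms, values are rational, as they have to be written down in the input. The matrices are
  only relevant at indices \<open>i < n\<close>, \<open>j < m\<close>.\<close>

definition nsw_instance :: "nat \<Rightarrow> nat \<Rightarrow> (nat \<Rightarrow> nat \<Rightarrow> rat) \<Rightarrow> bool" where
  "nsw_instance n m v \<longleftrightarrow> 1 \<le> n \<and> (\<forall>i<n. \<forall>j<m. 0 \<le> v i j)"

definition is_allocation :: "nat \<Rightarrow> nat \<Rightarrow> (nat \<Rightarrow> nat \<Rightarrow> int) \<Rightarrow> bool" where
  "is_allocation n m x \<longleftrightarrow>
     (\<forall>i<n. \<forall>j<m. x i j \<in> {0, 1}) \<and> (\<forall>j<m. \<exists>!i. i < n \<and> x i j = 1)"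

definition agent_value :: "nat \<Rightarrow> (nat \<Rightarrow> nat \<Rightarrow> rat) \<Rightarrow> (nat \<Rightarrow> nat \<Rightarrow> int) \<Rightarrow> nat \<Rightarrow> real" where
  "agent_value m v x i = (\<Sum>j<m. of_int (x i j) * of_rat (v i j))"

definition nsw :: "nat \<Rightarrow> nat \<Rightarrow> (nat \<Rightarrow> nat \<Rightarrow> rat) \<Rightarrow> (nat \<Rightarrow> nat \<Rightarrow> int) \<Rightarrow> real" where
  "nsw n m v x = root n (\<Prod>i<n. agent_value m v x i)"

definition opt_nsw :: "nat \<Rightarrow> nat \<Rightarrow> (nat \<Rightarrow> nat \<Rightarrow> rat) \<Rightarrow> real" where
  "opt_nsw n m v = Max (nsw n m v ` {x. is_allocation n m x})"

lemma finite_nsw_values: "finite (nsw n m v ` {x. is_allocation n m x})"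
proof (rule finite_surj)
  let ?I = "{..<n} \<times> {..<m}"
  show "finite (PiE ?I (\<lambda>_. {0, 1 :: int}))"
    by (intro finite_PiE) simp_all
  show "nsw n m v ` {x. is_allocation n m x} \<subseteq>
          (\<lambda>f. nsw n m v (\<lambda>i j. f (i, j))) ` (PiE ?I (\<lambda>_. {0, 1}))"
  proof (rule image_subsetI)
    fix x assume "x \<in> {x. is_allocation n m x}"
    then have x: "x i j \<in> {0, 1}" if "i < n" "j < m" for i j
      using that unfolding is_allocation_def by blast
    define f where "f = restrict (\<lambda>(i, j). x i j) ?I"
    have f: "f (i, j) = x i j" if "i < n" "j < m" for i j
      using that by (simp add: f_def)
    have "nsw n m v x = nsw n m v (\<lambda>i j. f (i, j))"
      by (simp add: nsw_def agent_value_def f)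
    moreover have "f \<in> PiE ?I (\<lambda>_. {0, 1})"
    proof (rule PiE_I)
      fix q assume "q \<in> ?I"
      then obtain i j where "q = (i, j)" "i < n" "j < m" by blast
      then show "f q \<in> {0, 1}" using x f by metis
    next
      fix q assume "q \<notin> ?I"
      then show "f q = undefined" unfolding f_def restrict_def by (rule if_not_P)
    qed
    ultimately show "nsw n m v x \<in> (\<lambda>f. nsw n m v (\<lambda>i j. f (i, j))) ` (PiE ?I (\<lambda>_. {0, 1}))"
      by (rule image_eqI)
  qed
qed

lemma opt_nsw_is_maximum:
  assumes "nsw_instance n m v"
  shows "\<exists>x. is_allocation n m x \<and> nsw n m v x = opt_nsw n m v"
    and "is_allocation n m y \<Longrightarrow> nsw n m v y \<le> opt_nsw n m v"
proof -
  have "is_allocation n m (\<lambda>i j. if i = 0 then 1 else 0)"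
    using assms by (auto simp: is_allocation_def nsw_instance_def)
  then have "opt_nsw n m v \<in> nsw n m v ` {x. is_allocation n m x}"
    unfolding opt_nsw_def by (intro Max_in finite_nsw_values) auto
  then show "\<exists>x. is_allocation n m x \<and> nsw n m v x = opt_nsw n m v"
    by auto
  show "is_allocation n m y \<Longrightarrow> nsw n m v y \<le> opt_nsw n m v"
    unfolding opt_nsw_def by (intro Max_ge finite_nsw_values) auto
qed

text \<open>The machine model is a probabilistic random access machine under the logarithmic cost
  criterion, programmed in a while language. Every program variable is an integer array indexed by
  integers (a scalar is the cell with index \<open>0\<close>). Evaluating any node of an expression costs the bit
  length of its value, so that the lengths of all addresses, operands and results are charged.\<close>

type_synonym vname = string
type_synonym state = "vname \<Rightarrow> int \<Rightarrow> int"

definition bit_size :: "int \<Rightarrow> nat" where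
  "bit_size k = Suc (floorlog 2 (nat \<bar>k\<bar>))"

datatype aexp =
    Const int
  | Cell vname aexp
  | Plus aexp aexp
  | Minus aexp aexp
  | Times aexp aexp
  | Divide aexp aexp

fun aval :: "aexp \<Rightarrow> state \<Rightarrow> int" where
  "aval (Const k) s = k"
| "aval (Cell x a) s = s x (aval a s)"
| "aval (Plus a b) s = aval a s + aval b s"
| "aval (Minus a b) s = aval a s - aval b s"
| "aval (Times a b) s = aval a s * aval b s"
| "aval (Divide a b) s = aval a s div aval b s"

fun acost :: "aexp \<Rightarrow> state \<Rightarrow> nat" where
  "acost (Const k) s = bit_size k"
| "acost (Cell x a) s = acost a s + bit_size (aval (Cell x a) s)"
| "acost (Plus a b) s = acost a s + acost b s + bit_size (aval (Plus a b) s)"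
| "acost (Minus a b) s = acost a s + acost b s + bit_size (aval (Minus a b) s)"
| "acost (Times a b) s = acost a s + acost b s + bit_size (aval (Times a b) s)"
| "acost (Divide a b) s = acost a s + acost b s + bit_size (aval (Divide a b) s)"

datatype bexp =
    Less aexp aexp
  | Equal aexp aexp
  | Neg bexp
  | Conj bexp bexp

fun bval :: "bexp \<Rightarrow> state \<Rightarrow> bool" where
  "bval (Less a b) s \<longleftrightarrow> aval a s < aval b s"
| "bval (Equal a b) s \<longleftrightarrow> aval a s = aval b s"
| "bval (Neg b) s \<longleftrightarrow> \<not> bval b s"
| "bval (Conj b c) s \<longleftrightarrow> bval b s \<and> bval c s"

fun bcost :: "bexp \<Rightarrow> state \<Rightarrow> nat" where
  "bcost (Less a b) s = acost a s + acost b s + 1"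
| "bcost (Equal a b) s = acost a s + acost b s + 1"
| "bcost (Neg b) s = bcost b s + 1"
| "bcost (Conj b c) s = bcost b s + bcost c s + 1"

text \<open>\<open>Assign x a b\<close> is \<open>x[a] := b\<close>, and \<open>Toss x a\<close> stores the outcome of a fresh fair coin toss,
  \<open>0\<close> or \<open>1\<close>, in \<open>x[a]\<close>.\<close>

datatype com =
    Skip
  | Assign vname aexp aexp
  | Toss vname aexp
  | Seq com com
  | If bexp com com
  | While bexp com

definition update :: "state \<Rightarrow> vname \<Rightarrow> int \<Rightarrow> int \<Rightarrow> state" where
  "update s x k y = s(x := (s x)(k := y))"

text \<open>One step yields the remaining program, the new state, and the cost of the step. A computation
  has halted iff the remaining program is \<open>Skip\<close>; any other step costs at least \<open>1\<close>.\<close>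

fun step :: "com \<Rightarrow> state \<Rightarrow> (com \<times> state \<times> nat) pmf" where
  "step Skip s = return_pmf (Skip, s, 0)"
| "step (Assign x a b) s =
     return_pmf (Skip, update s x (aval a s) (aval b s), acost a s + acost b s + 1)"
| "step (Toss x a) s =
     map_pmf (\<lambda>r. (Skip, update s x (aval a s) (of_bool r), acost a s + 1)) (bernoulli_pmf (1/2))"
| "step (Seq c d) s =
     (if c = Skip then return_pmf (d, s, 1)
      else map_pmf (\<lambda>(c', s', k). (Seq c' d, s', k)) (step c s))"
| "step (If b c d) s = return_pmf (if bval b s then c else d, s, bcost b s + 1)"
| "step (While b c) s =
     return_pmf (if bval b s then Seq c (While b c) else Skip, s, bcost b s + 1)"

text \<open>\<open>run N P s\<close> is the distribution of the remaining program, the state and the accumulated cost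
  after \<open>N\<close> steps.\<close>

primrec run :: "nat \<Rightarrow> com \<Rightarrow> state \<Rightarrow> (com \<times> state \<times> nat) pmf" where
  "run 0 P s = return_pmf (P, s, 0)"
| "run (Suc N) P s =
     bind_pmf (run N P s) (\<lambda>(c, s', t). map_pmf (\<lambda>(c', s'', k). (c', s'', t + k)) (step c s'))"

text \<open>The program halts at total cost at most \<open>N\<close>, whatever the outcomes of the coin tosses. As steps
  before halting cost at least \<open>1\<close>, it does so within \<open>N\<close> steps.\<close>

definition halts_within :: "nat \<Rightarrow> com \<Rightarrow> state \<Rightarrow> bool" where
  "halts_within N P s \<longleftrightarrow> (\<forall>(c, s', t) \<in> set_pmf (run N P s). c = Skip \<and> t \<le> N)"

lemma step_cost_pos:
  assumes "(c', s', k) \<in> set_pmf (step c s)" "c \<noteq> Skip"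
  shows "1 \<le> k"
  using assms
proof (induction c arbitrary: c')
  case (Seq c d)
  then show ?case
    by (cases "c = Skip") auto
qed auto

text \<open>The value of agent \<open>i\<close> for item \<open>j\<close> is given as a reduced fraction, whose numerator and
  denominator are in row-major order in the arrays \<open>num\<close> and \<open>den\<close>; all other cells are zero.\<close>

definition input_state :: "nat \<Rightarrow> nat \<Rightarrow> (nat \<Rightarrow> nat \<Rightarrow> rat) \<Rightarrow> state" where
  "input_state n m v x k =
     (let q = quotient_of (v (nat k div m) (nat k mod m)); valid = (0 \<le> k \<and> k < int (n * m)) in
      if x = ''n'' \<and> k = 0 then int n
      else if x = ''m'' \<and> k = 0 then int m
      else if x = ''num'' \<and> valid then fst q
      else if x = ''den'' \<and> valid then snd q
      else 0)"

definition input_size :: "nat \<Rightarrow> nat \<Rightarrow> (nat \<Rightarrow> nat \<Rightarrow> rat) \<Rightarrow> nat" where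
  "input_size n m v = n + m +
     (\<Sum>i<n. \<Sum>j<m. bit_size (fst (quotient_of (v i j))) + bit_size (snd (quotient_of (v i j))))"

text \<open>The returned matrix is read off the array \<open>x\<close>, in row-major order.\<close>

definition output_of :: "nat \<Rightarrow> state \<Rightarrow> nat \<Rightarrow> nat \<Rightarrow> int" where
  "output_of m s i j = s ''x'' (int (i * m + j))"

end

theory Submission
  imports Defs
begin

text \<open>A deterministic ascending auction already achieves a factor below \<open>e\<close>. Item \<open>j\<close> has a price
  \<open>p\<^sub>j + 4\<close>, and an agent is poor if the \<open>p\<^sub>j\<close> of her items sum up to less than \<open>L = 40 m\<close>. A poor agent
  takes the item with the best ratio of value to price from its owner and raises its price by a
  factor between \<open>9/8\<close> and \<open>5/4\<close>. Hence each agent always holds items of nearly (up to \<open>5/4\<close>) best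
  ratio, and her \<open>p\<^sub>j\<close> sum up to at most \<open>L\<close> if one item is left out.

  If the optimum is positive, then prices stay below \<open>2\<close> to the power of a polynomial: otherwise
  there is a large gap in the prices, and the owners of the items above it together with a further
  poor agent only value these items, although each owner has just one of them, which violates Hall's
  condition. So after polynomially many bids nobody is poor. Then, with one item \<open>g\<^sub>h\<close> left out for each
  agent \<open>h\<close>, the remaining \<open>p\<^sub>j\<close> sum up to at most \<open>n L\<close>, and AM-GM shows that no allocation has a
  product of prices above \<open>(21/10)\<^sup>n\<close> times the product of the current spendings. The total loss is
  \<open>5/4 \<cdot> 21/10 = 21/8 < e\<close>.\<close>

section \<open>Running time\<close>

text \<open>A compositional semantics that counts machine steps, while costs are bounded separately.
  The extra 1 for \<open>Seq\<close> is the step that drops \<open>Skip\<close>; the extra 2 for a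
  loop iteration are the test and such a drop. There is no rule for \<open>Toss\<close>, as the
  auction tosses no coins.\<close>

inductive exec :: "com \<Rightarrow> state \<Rightarrow> nat \<Rightarrow> state \<Rightarrow> bool" where
  exec_Skip: "exec Skip s 0 s"
| exec_Assign: "exec (Assign x a b) s 1 (update s x (aval a s) (aval b s))"
| exec_Seq: "exec c s k s' \<Longrightarrow> exec d s' l s'' \<Longrightarrow> exec (Seq c d) s (k + l + 1) s''"
| exec_IfTrue: "bval b s \<Longrightarrow> exec c s k s' \<Longrightarrow> exec (If b c d) s (k + 1) s'"
| exec_IfFalse: "\<not> bval b s \<Longrightarrow> exec d s k s' \<Longrightarrow> exec (If b c d) s (k + 1) s'"
| exec_WhileTrue: "bval b s \<Longrightarrow> exec c s k s' \<Longrightarrow> exec (While b c) s' l s'' \<Longrightarrow>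
    exec (While b c) s (k + l + 2) s''"
| exec_WhileFalse: "\<not> bval b s \<Longrightarrow> exec (While b c) s 1 s"

lemma exec_Assign_eq: "s' = update s x (aval a s) (aval b s) \<Longrightarrow> exec (Assign x a b) s 1 s'"
  using exec_Assign by simp

lemma exec_Assign_Seq:
  assumes "exec d (update s x (aval a s) (aval b s)) k s'"
  shows "exec (Seq (Assign x a b) d) s (k + 2) s'"
  using exec_Seq[OF exec_Assign assms] by simp

inductive steps :: "com \<Rightarrow> state \<Rightarrow> nat \<Rightarrow> nat \<Rightarrow> com \<Rightarrow> state \<Rightarrow> bool" where
  steps_refl: "steps c s 0 0 c s"
| steps_step: "c \<noteq> Skip \<Longrightarrow> step c s = return_pmf (c', s', t) \<Longrightarrow> steps c' s' k t' d s'' \<Longrightarrow>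
    steps c s (Suc k) (t + t') d s''"

lemma steps_trans:
  assumes "steps c s k t c' s'" "steps c' s' k' t' c'' s''"
  shows "steps c s (k + k') (t + t') c'' s''"
  using assms by (induction rule: steps.induct) (auto intro: steps_step simp: add.assoc)

lemma steps_one:
  assumes "c \<noteq> Skip" "step c s = return_pmf (c', s', t)"
  shows "steps c s 1 t c' s'"
  using steps_step[OF assms steps_refl] by simp

lemma steps_Seq:
  assumes "steps c s k t c' s'"
  shows "steps (Seq c d) s k t (Seq c' d) s'"
  using assms
proof (induction rule: steps.induct)
  case (steps_step c s c' s' t k t' d' s'')
  then show ?case
    by (intro steps.steps_step[where c' = "Seq c' d"]) auto
qed (rule steps_refl)

lemma steps_if_exec:
  assumes "exec c s k s'"
  shows "\<exists>t. steps c s k t Skip s'"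
  using assms
proof (induction rule: exec.induct)
  case (exec_Skip s)
  then show ?case using steps_refl by blast
next
  case (exec_Assign x a b s)
  then show ?case by (intro exI steps_one) auto
next
  case (exec_Seq c s k s' d l s'')
  then obtain t t' where "steps c s k t Skip s'" and *: "steps d s' l t' Skip s''" by blast
  have "steps (Seq c d) s k t (Seq Skip d) s'"
    using \<open>steps c s k t Skip s'\<close> by (rule steps_Seq)
  moreover have "steps (Seq Skip d) s' 1 1 d s'" by (rule steps_one) auto
  ultimately have "steps (Seq c d) s (k + (1 + l)) (t + (1 + t')) Skip s''"
    using * by (blast intro: steps_trans)
  then show ?case by (auto simp: ac_simps)
next
  case (exec_IfTrue b s c k s' d)
  then obtain t where *: "steps c s k t Skip s'" by blast
  have "steps (If b c d) s 1 (bcost b s + 1) c s"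
    using exec_IfTrue by (intro steps_one) auto
  from steps_trans[OF this *] show ?case by auto
next
  case (exec_IfFalse b s d k s' c)
  then obtain t where *: "steps d s k t Skip s'" by blast
  have "steps (If b c d) s 1 (bcost b s + 1) d s"
    using exec_IfFalse by (intro steps_one) auto
  from steps_trans[OF this *] show ?case by auto
next
  case (exec_WhileTrue b s c k s' l s'')
  then obtain t t' where 1: "steps c s k t Skip s'" and 2: "steps (While b c) s' l t' Skip s''"
    by blast
  have "steps (While b c) s 1 (bcost b s + 1) (Seq c (While b c)) s"
    using exec_WhileTrue by (intro steps_one) auto
  moreover have "steps (Seq c (While b c)) s k t (Seq Skip (While b c)) s'"
    using 1 by (rule steps_Seq)
  moreover have "steps (Seq Skip (While b c)) s' 1 1 (While b c) s'" by (rule steps_one) auto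
  ultimately have "steps (While b c) s (1 + (k + (1 + l))) (bcost b s + 1 + (t + (1 + t'))) Skip s''"
    using 2 by (blast intro: steps_trans)
  then show ?case by (auto simp: ac_simps numeral_2_eq_2)
next
  case (exec_WhileFalse b s c)
  then show ?case by (intro exI steps_one) auto
qed

text \<open>\<open>run\<close> appends its last step, whereas \<open>steps\<close> peels off the
  first one; associativity of bind reconciles the two.\<close>

lemma run_Suc_left:
  "run (Suc k) c s =
     bind_pmf (step c s) (\<lambda>(c', s', t). map_pmf (\<lambda>(d, s'', t'). (d, s'', t + t')) (run k c' s'))"
proof (induction k)
  case 0
  show ?case
    by (simp add: bind_return_pmf map_pmf_def case_prod_beta')
next
  case (Suc k)
  have "run (Suc (Suc k)) c s = bind_pmf (run (Suc k) c s)
      (\<lambda>(c, s', t). map_pmf (\<lambda>(c', s'', k). (c', s'', t + k)) (step c s'))"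
    by (rule run.simps)
  also have "\<dots> = bind_pmf (step c s) (\<lambda>(c', s', t). map_pmf (\<lambda>(d, s'', t'). (d, s'', t + t')) (run (Suc k) c' s'))"
    unfolding Suc.IH
    by (simp add: bind_assoc_pmf map_pmf_def bind_return_pmf case_prod_beta' add.assoc)
  finally show ?case .
qed

lemma run_Skip: "run k Skip s = return_pmf (Skip, s, 0)"
  by (induction k) (auto simp: bind_return_pmf)

text \<open>A halted program idles at cost 0, so the surplus \<open>l\<close> of steps changes
  nothing. This allows a time bound as the number of steps of a run.\<close>

lemma run_if_steps:
  assumes "steps c s k t Skip s'"
  shows "run (k + l) c s = return_pmf (Skip, s', t)"
  using assms
proof (induction c s k t "Skip" s' rule: steps.induct)
  case (steps_refl s)
  then show ?case by (simp add: run_Skip)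
next
  case (steps_step c s c' s' t k t' s'')
  then show ?case
    by (simp add: run_Suc_left bind_return_pmf del: run.simps)
qed

section \<open>Bit lengths and cost\<close>

definition bounded_state :: "nat \<Rightarrow> state \<Rightarrow> bool" where
  "bounded_state w s \<longleftrightarrow> (\<forall>x k. \<bar>s x k\<bar> < 2 ^ w)"

lemma bit_size_le: "\<bar>k\<bar> < 2 ^ w \<Longrightarrow> bit_size k \<le> w + 1"
  by (simp add: bit_size_def floorlog_le_iff nat_less_iff)

lemma less_two_power_bit_size: "\<bar>k\<bar> < 2 ^ bit_size k"
proof -
  have "nat \<bar>k\<bar> < 2 ^ bit_size k"
    by (rule floorlog_leD) (simp_all add: bit_size_def)
  then show ?thesis by (simp add: nat_less_iff)
qed

text \<open>A constant weighs its bit length, so that bounds on values and costs depend on an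
  expression only through this number.\<close>

fun asize :: "aexp \<Rightarrow> nat" where
  "asize (Const k) = bit_size k"
| "asize (Cell x a) = asize a + 1"
| "asize (Plus a b) = asize a + asize b + 1"
| "asize (Minus a b) = asize a + asize b + 1"
| "asize (Times a b) = asize a + asize b + 1"
| "asize (Divide a b) = asize a + asize b + 1"

fun bsize :: "bexp \<Rightarrow> nat" where
  "bsize (Less a b) = asize a + asize b + 1"
| "bsize (Equal a b) = asize a + asize b + 1"
| "bsize (Neg b) = bsize b + 1"
| "bsize (Conj b c) = bsize b + bsize c + 1"

text \<open>If products are only used in addresses and tests, never stored, then the bit lengths of all
  stored numbers grow by at most a constant per step, so a polynomial number of steps suffices for
  polynomial cost.\<close>

fun additive_aexp :: "aexp \<Rightarrow> bool" where
  "additive_aexp (Times a b) = False"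
| "additive_aexp (Plus a b) = (additive_aexp a \<and> additive_aexp b)"
| "additive_aexp (Minus a b) = (additive_aexp a \<and> additive_aexp b)"
| "additive_aexp (Divide a b) = additive_aexp a"
| "additive_aexp (Const k) = True"
| "additive_aexp (Cell x a) = True"

text \<open>\<open>z\<close> bounds all expression sizes and thereby the number of bits gained per
  step. An address may contain products because it is not stored.\<close>

fun additive_com :: "nat \<Rightarrow> com \<Rightarrow> bool" where
  "additive_com z Skip = True"
| "additive_com z (Assign x a b) = (additive_aexp b \<and> asize a + asize b \<le> z)"
| "additive_com z (Toss x a) = False"
| "additive_com z (Seq c d) = (additive_com z c \<and> additive_com z d)"
| "additive_com z (If b c d) = (bsize b \<le> z \<and> additive_com z c \<and> additive_com z d)"
| "additive_com z (While b c) = (bsize b \<le> z \<and> additive_com z c)"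

lemma asize_pos: "0 < asize a"
  by (cases a) (auto simp: bit_size_def)

text \<open>Rounding down could only hurt for a negative quotient. Then, after flipping both signs
  if necessary, the numerator is negative and the divisor at least 1, and dividing by 1 instead
  gives a lower bound.\<close>

lemma abs_div_le: "\<bar>a div b\<bar> \<le> \<bar>a\<bar>" for a b :: int
proof (cases "b = 0")
  case False
  show ?thesis
  proof (cases "0 \<le> a div b")
    case True
    have "\<bar>a div b\<bar> * 1 \<le> \<bar>a div b\<bar> * \<bar>b\<bar>" using False by (intro mult_left_mono) auto
    moreover have "\<bar>a div b\<bar> * \<bar>b\<bar> \<le> \<bar>a\<bar>"
    proof -
      have "a = a div b * b + a mod b" by simp
      show ?thesis
      proof (cases "b > 0")
        case True
        then have "a div b * b \<le> a" using \<open>a = _\<close> pos_mod_sign[OF True, of a] by linarith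
        then show ?thesis using True \<open>0 \<le> a div b\<close> by simp
      next
        case F: False
        then have "b < 0" using False by simp
        then have "a \<le> a div b * b" using \<open>a = _\<close> neg_mod_sign[OF \<open>b < 0\<close>, of a] by linarith
        then show ?thesis using \<open>b < 0\<close> \<open>0 \<le> a div b\<close> 
          by (auto simp: abs_if)
      qed
    qed
    ultimately show ?thesis by linarith
  next
    case neg: False
    show ?thesis
    proof (cases "b > 0")
      case True
      then have "a < 0" using neg by (meson not_less pos_imp_zdiv_nonneg_iff)
      have "a div b \<ge> a div 1"
        using \<open>a < 0\<close> True by (intro zdiv_mono2_neg) auto
      then show ?thesis using neg \<open>a < 0\<close> by simp
    next
      case F: False
      then have "b < 0" using False by simp
      then have "a > 0" using neg by (metis neg_imp_zdiv_nonneg_iff not_less)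
      have "(-a) div (-b) \<ge> (-a) div 1"
        using \<open>a > 0\<close> \<open>b < 0\<close> by (intro zdiv_mono2_neg) auto
      then show ?thesis using neg \<open>a > 0\<close> by simp
    qed
  qed
qed simp

lemma power_two_add_le: "x \<ge> 1 \<Longrightarrow> y \<ge> 1 \<Longrightarrow> (2::int) ^ x + 2 ^ y \<le> 2 ^ (x + y)"
proof -
  assume "x \<ge> 1" "y \<ge> 1"
  then have "(2::int) ^ 1 \<le> 2 ^ x" "(2::int) ^ 1 \<le> 2 ^ y" by (simp_all only: power_increasing_iff one_less_numeral_iff semiring_norm)
  \<comment> \<open>The sum of these two inequalities is the claim.\<close>
  then have "0 \<le> ((2::int) ^ x - 2) * (2 ^ y - 2)" "0 \<le> (2::int) ^ x - 2 + (2 ^ y - 2)" by simp_all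
  then show ?thesis by (simp add: algebra_simps power_add)
qed

lemma less_power_two_mono: "\<bar>k\<bar> < 2 ^ w \<Longrightarrow> w \<le> z \<Longrightarrow> \<bar>k\<bar> < 2 ^ z" for k :: int
  using power_increasing[of w z "2::int"] by linarith

text \<open>A product adds the bit lengths of its factors and the other operations do no worse, so
  each unit of size contributes at most \<open>w + 1\<close> bits.\<close>

lemma abs_aval_less:
  assumes "bounded_state w s"
  shows "\<bar>aval a s\<bar> < 2 ^ (asize a * (w + 1))"
proof (induction a)
  case (Const k)
  show ?case using less_power_two_mono[OF less_two_power_bit_size, of k] by simp
next
  case (Cell x a)
  have "\<bar>s x (aval a s)\<bar> < 2 ^ w" using assms unfolding bounded_state_def by blast
  then show ?case unfolding aval.simps by (rule less_power_two_mono) simp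
next
  case (Divide a b)
  have "\<bar>aval (Divide a b) s\<bar> \<le> \<bar>aval a s\<bar>" by (simp add: abs_div_le)
  also have "\<dots> < 2 ^ (asize a * (w + 1))" by (rule Divide)
  also have "\<dots> \<le> (2::int) ^ (asize (Divide a b) * (w + 1))" by (intro power_increasing mult_right_mono) auto
  finally show ?case .
next
  case (Times a b)
  have "\<bar>aval (Times a b) s\<bar> = \<bar>aval a s\<bar> * \<bar>aval b s\<bar>" by (simp add: abs_mult)
  also have "\<dots> < 2 ^ (asize a * (w + 1)) * 2 ^ (asize b * (w + 1))"
    using Times by (intro mult_strict_mono') auto
  also have "\<dots> = 2 ^ ((asize a + asize b) * (w + 1))"
    by (simp add: power_add[symmetric] algebra_simps)
  also have "\<dots> \<le> (2::int) ^ (asize (Times a b) * (w + 1))"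
    by (intro power_increasing mult_right_mono) auto
  finally show ?case .
next
  case (Plus a b)
  have "\<bar>aval (Plus a b) s\<bar> < 2 ^ (asize a * (w + 1)) + 2 ^ (asize b * (w + 1))" using Plus by simp
  also have "\<dots> \<le> 2 ^ (asize a * (w + 1) + asize b * (w + 1))"
    using asize_pos[of a] asize_pos[of b] by (intro power_two_add_le) auto
  also have "\<dots> \<le> (2::int) ^ (asize (Plus a b) * (w + 1))"
    by (intro power_increasing) (auto simp: algebra_simps)
  finally show ?case .
next
  case (Minus a b)
  have "\<bar>aval (Minus a b) s\<bar> < 2 ^ (asize a * (w + 1)) + 2 ^ (asize b * (w + 1))" using Minus by simp
  also have "\<dots> \<le> 2 ^ (asize a * (w + 1) + asize b * (w + 1))"
    using asize_pos[of a] asize_pos[of b] by (intro power_two_add_le) auto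
  also have "\<dots> \<le> (2::int) ^ (asize (Minus a b) * (w + 1))"
    by (intro power_increasing) (auto simp: algebra_simps)
  finally show ?case .
qed

text \<open>For sums and differences the common factor \<open>2 ^ w\<close> can be pulled out, so
  \<open>w\<close> enters only once instead of once per node.\<close>

lemma abs_aval_additive_less:
  assumes "bounded_state w s" "additive_aexp a"
  shows "\<bar>aval a s\<bar> < 2 ^ (w + asize a)"
  using assms(2)
proof (induction a)
  case (Const k)
  show ?case using less_power_two_mono[OF less_two_power_bit_size, of k] by simp
next
  case (Cell x a)
  have "\<bar>s x (aval a s)\<bar> < 2 ^ w" using assms unfolding bounded_state_def by blast
  then show ?case unfolding aval.simps by (rule less_power_two_mono) simp
next
  case (Divide a b)
  have "\<bar>aval (Divide a b) s\<bar> \<le> \<bar>aval a s\<bar>" by (simp add: abs_div_le)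
  also have "\<dots> < 2 ^ (w + asize a)" using Divide by simp
  also have "\<dots> \<le> (2::int) ^ (w + asize (Divide a b))" by (intro power_increasing) auto
  finally show ?case .
next
  case (Plus a b)
  have "\<bar>aval (Plus a b) s\<bar> < 2 ^ (w + asize a) + 2 ^ (w + asize b)" using Plus by simp
  also have "\<dots> = 2 ^ w * (2 ^ asize a + 2 ^ asize b)" by (simp add: power_add algebra_simps)
  also have "\<dots> \<le> 2 ^ w * 2 ^ (asize a + asize b)"
    using asize_pos[of a] asize_pos[of b] by (intro mult_left_mono power_two_add_le) auto
  also have "\<dots> \<le> (2::int) ^ (w + asize (Plus a b))" by (simp add: power_add)
  finally show ?case .
next
  case (Minus a b)
  have "\<bar>aval (Minus a b) s\<bar> < 2 ^ (w + asize a) + 2 ^ (w + asize b)" using Minus by simp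
  also have "\<dots> = 2 ^ w * (2 ^ asize a + 2 ^ asize b)" by (simp add: power_add algebra_simps)
  also have "\<dots> \<le> 2 ^ w * 2 ^ (asize a + asize b)"
    using asize_pos[of a] asize_pos[of b] by (intro mult_left_mono power_two_add_le) auto
  also have "\<dots> \<le> (2::int) ^ (w + asize (Minus a b))" by (simp add: power_add)
  finally show ?case .
qed simp

text \<open>Each node is paid for by a unit of size, and its value has at most
  \<open>z * (w + 1)\<close> bits.\<close>

lemma acost_le:
  assumes "bounded_state w s" "asize a \<le> z"
  shows "acost a s \<le> asize a * (z * (w + 1) + 1)"
proof -
  have node: "bit_size (aval a s) \<le> z * (w + 1) + 1" if "asize a \<le> z" for a
    by (intro bit_size_le less_power_two_mono[OF abs_aval_less[OF assms(1)]] mult_right_mono that) simp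
  from assms(2) show ?thesis
  proof (induction a)
    case (Const k)
    then show ?case by simp
  next
    case (Cell x a)
    then show ?case using node[of "Cell x a"] by (simp add: add_mult_distrib)
  next
    case (Plus a b)
    then show ?case using node[of "Plus a b"] by (simp add: add_mult_distrib)
  next
    case (Minus a b)
    then show ?case using node[of "Minus a b"] by (simp add: add_mult_distrib)
  next
    case (Times a b)
    then show ?case using node[of "Times a b"] by (simp add: add_mult_distrib)
  next
    case (Divide a b)
    then show ?case using node[of "Divide a b"] by (simp add: add_mult_distrib)
  qed
qed

lemma bcost_le:
  assumes "bounded_state w s" "bsize b \<le> z"
  shows "bcost b s \<le> bsize b * (z * (w + 1) + 1)"
  using assms(2)
proof (induction b)
  case (Less a b)
  then show ?case using acost_le[OF assms(1), of a z] acost_le[OF assms(1), of b z]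
    by (simp add: add_mult_distrib)
next
  case (Equal a b)
  then show ?case using acost_le[OF assms(1), of a z] acost_le[OF assms(1), of b z]
    by (simp add: add_mult_distrib)
qed (auto simp: add_mult_distrib)

lemma step_additive_com:
  assumes "(c', s', t) \<in> set_pmf (step c s)" "additive_com z c" "bounded_state w s"
  shows "additive_com z c' \<and> bounded_state (w + z) s' \<and> t \<le> z * (z * (w + 1) + 1) + 1"
proof -
  have mono: "bounded_state (w + z) s"
    using assms(3) unfolding bounded_state_def by (meson less_power_two_mono le_add1)
  have bcost: "bcost b s \<le> z * (z * (w + 1) + 1)" if "bsize b \<le> z" for b
    using bcost_le[OF assms(3) that] mult_right_mono[OF that, of "z * (w + 1) + 1"] by simp
  show ?thesis
    using assms(1,2)
  proof (induction c arbitrary: c')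
    case Skip
    then show ?case using mono by auto
  next
    case (Assign x a b)
    then have z: "asize a + asize b \<le> z" "additive_aexp b" by auto
    have eq: "s' = update s x (aval a s) (aval b s)" "t = acost a s + acost b s + 1" "c' = Skip"
      using Assign by auto
    have "acost a s + acost b s \<le> (asize a + asize b) * (z * (w + 1) + 1)"
      using acost_le[OF assms(3), of a z] acost_le[OF assms(3), of b z] z
      by (simp add: add_mult_distrib)
    also have "\<dots> \<le> z * (z * (w + 1) + 1)" using z by (intro mult_right_mono) auto
    finally have "t \<le> z * (z * (w + 1) + 1) + 1" using eq by simp
    moreover have "bounded_state (w + z) s'"
      unfolding bounded_state_def eq(1) update_def
      using assms(3) less_power_two_mono[OF abs_aval_additive_less[OF assms(3) z(2)], of "w + z"] z
        mono unfolding bounded_state_def by auto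
    ultimately show ?case using eq by simp
  next
    case (Toss x a)
    then show ?case by simp
  next
    case (Seq c d)
    show ?case
    proof (cases "c = Skip")
      case True
      then show ?thesis using Seq mono by auto
    next
      case False
      then obtain c'' where "(c'', s', t) \<in> set_pmf (step c s)" "c' = Seq c'' d"
        using Seq.prems by auto
      then show ?thesis using Seq by auto
    qed
  next
    case (If b c d)
    then show ?case using mono bcost by (auto split: if_splits)
  next
    case (While b c)
    then show ?case using mono bcost by (auto split: if_splits)
  qed
qed

text \<open>Stored numbers gain at most \<open>z\<close> bits per step, hence never exceed
  \<open>w + k * z\<close> bits, and each of the \<open>k\<close> steps is charged for that
  length.\<close>

lemma steps_cost_le:
  assumes "steps c s k t c' s'" "additive_com z c" "bounded_state w s"
  shows "t \<le> k * (z * (z * (w + k * z + 1) + 1) + 1)"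
  using assms
proof (induction arbitrary: w rule: steps.induct)
  case (steps_step c s c1 s1 t k t' d s'')
  have *: "additive_com z c1" "bounded_state (w + z) s1" "t \<le> z * (z * (w + 1) + 1) + 1"
    using step_additive_com[of c1 s1 t c s z w] steps_step by auto
  have "t' \<le> k * (z * (z * (w + z + k * z + 1) + 1) + 1)"
    using steps_step.IH * by blast
  moreover have "z * (z * (w + 1) + 1) + 1 \<le> z * (z * (w + Suc k * z + 1) + 1) + 1"
    by (intro add_mono mult_mono) auto
  ultimately show ?case using *(3) by (simp add: algebra_simps)
qed simp

text \<open>As in \<open>halts_within\<close>, \<open>T\<close> is both the number of steps of the
  run and the bound on its cost.\<close>

lemma run_if_exec:
  assumes "exec c s k s'" "additive_com z c" "bounded_state w s"
  assumes "k \<le> K" "K * (z * (z * (w + K * z + 1) + 1) + 1) \<le> T"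
  shows "\<exists>t\<le>T. run T c s = return_pmf (Skip, s', t)"
proof -
  obtain t where t: "steps c s k t Skip s'" using steps_if_exec[OF assms(1)] by blast
  have "k * 1 \<le> K * (z * (z * (w + K * z + 1) + 1) + 1)"
    using assms(4) by (intro mult_mono) auto
  then have "k \<le> T" using assms(5) by simp
  then have "run T c s = return_pmf (Skip, s', t)"
    using run_if_steps[OF t, of "T - k"] by simp
  moreover have "t \<le> k * (z * (z * (w + k * z + 1) + 1) + 1)"
    using steps_cost_le[OF t assms(2,3)] .
  moreover have "\<dots> \<le> K * (z * (z * (w + K * z + 1) + 1) + 1)"
    using assms(4) by (intro mult_mono add_mono) auto
  ultimately show ?thesis using assms(5) by auto
qed

text \<open>The variant \<open>\<mu>\<close> bounds the number of iterations, each taking the body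
  and 2 further steps; the last test takes 1.\<close>

lemma exec_While:
  fixes \<mu> :: "state \<Rightarrow> nat"
  assumes body: "\<And>s. I s \<Longrightarrow> bval b s \<Longrightarrow> \<exists>k s'. exec c s k s' \<and> k \<le> K \<and> I s' \<and> \<mu> s' < \<mu> s"
    and "I s"
  shows "\<exists>k s'. exec (While b c) s k s' \<and> k \<le> (K + 2) * \<mu> s + 1 \<and> I s' \<and> \<not> bval b s'"
  using \<open>I s\<close>
proof (induction "\<mu> s" arbitrary: s rule: less_induct)
  case less
  show ?case
  proof (cases "bval b s")
    case True
    then obtain k s' where s': "exec c s k s'" "k \<le> K" "I s'" "\<mu> s' < \<mu> s"
      using body less.prems by blast
    then obtain l s'' where s'': "exec (While b c) s' l s''" "l \<le> (K + 2) * \<mu> s' + 1" "I s''" "\<not> bval b s''"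
      using less.hyps by blast
    have "exec (While b c) s (k + l + 2) s''"
      using True s' s'' by (blast intro: exec_WhileTrue)
    moreover have "(K + 2) * (\<mu> s' + 1) \<le> (K + 2) * \<mu> s"
      using s'(4) by (intro mult_left_mono) auto
    then have "k + l + 2 \<le> (K + 2) * \<mu> s + 1" using s' s'' by simp
    ultimately show ?thesis using s'' by blast
  next
    case False
    then show ?thesis using exec_WhileFalse less.prems by fastforce
  qed
qed

section \<open>The auction\<close>

definition items_of :: "nat \<Rightarrow> (nat \<Rightarrow> nat) \<Rightarrow> nat \<Rightarrow> nat set" where
  "items_of m ow i = {j. j < m \<and> ow j = i}"

lemma finite_items_of [simp]: "finite (items_of m ow i)"
  by (simp add: items_of_def)

text \<open>The third condition says that items whose price was raised have nearly best ratio of value to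
  price for their owners; the initial price of an item is \<open>4\<close>, so that \<open>p j = 0\<close> stands for an item
  without a bid.\<close>

definition auction_inv ::
  "nat \<Rightarrow> nat \<Rightarrow> (nat \<Rightarrow> nat \<Rightarrow> real) \<Rightarrow> int \<Rightarrow> (nat \<Rightarrow> int) \<Rightarrow> (nat \<Rightarrow> nat) \<Rightarrow> bool" where
  "auction_inv n m u L p ow \<longleftrightarrow>
     (\<forall>j<m. ow j < n \<and> 0 \<le> p j) \<and>
     (\<forall>h<n. \<exists>g. sum p (items_of m ow h - {g}) \<le> L) \<and>
     (\<forall>j<m. 0 < p j \<longrightarrow> (\<forall>j'<m. 4 * u (ow j) j' * (p j + 4) \<le> 5 * u (ow j) j * (p j' + 4)))"

definition best_item :: "nat \<Rightarrow> (nat \<Rightarrow> nat \<Rightarrow> real) \<Rightarrow> (nat \<Rightarrow> int) \<Rightarrow> nat \<Rightarrow> nat \<Rightarrow> bool" where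
  "best_item m u p i b \<longleftrightarrow> b < m \<and> (\<forall>j<m. u i j * (p b + 4) \<le> u i b * (p j + 4))"

text \<open>In terms of the full price \<open>q = k + 4\<close> this is \<open>q + q div 4\<close>.
  As \<open>q\<close> is at least 4, the rounded quarter is at least \<open>q / 8\<close>, which
  gives the factor \<open>9/8\<close>; this is why prices start at 4.\<close>

definition raise :: "int \<Rightarrow> int" where
  "raise k = k + (k div 4 + 1)"

lemma raise_bounds:
  assumes "0 \<le> k"
  shows "0 < raise k" "k \<le> raise k" "4 * (raise k + 4) \<le> 5 * (k + 4)" "9 * (k + 4) \<le> 8 * (raise k + 4)"
  using assms unfolding raise_def by presburger+

text \<open>Only the price of \<open>b\<close> changes, and it grows. Ratios of other items held by
  agents thus stay nearly best, and \<open>b\<close>, which was exactly best for \<open>i\<close> at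
  the old price, loses a factor of at most \<open>5/4\<close>.\<close>

lemma auction_inv_bid:
  assumes inv: "auction_inv n m u L p ow" and i: "i < n" and poor: "sum p (items_of m ow i) \<le> L"
    and best: "best_item m u p i b" and u: "\<And>i j. i < n \<Longrightarrow> j < m \<Longrightarrow> 0 \<le> u i j"
  shows "auction_inv n m u L (p(b := raise (p b))) (ow(b := i))"
proof -
  let ?p = "p(b := raise (p b))" and ?ow = "ow(b := i)"
  have b: "b < m" using best by (simp add: best_item_def)
  have p: "0 \<le> p j" "ow j < n" if "j < m" for j using inv that by (auto simp: auction_inv_def)
  note raise = raise_bounds[OF p(1)[OF b]]
  have le: "p j \<le> ?p j" for j using raise by simp
  have 1: "\<forall>j<m. ?ow j < n \<and> 0 \<le> ?p j" using p i raise by auto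
  have 2: "\<exists>g. sum ?p (items_of m ?ow h - {g}) \<le> L" if "h < n" for h
  proof (cases "h = i")
    case True
    \<comment> \<open>The bidder leaves out \<open>b\<close>: she held the rest while still
      poor.\<close>
    have "sum ?p (items_of m ?ow i - {b}) = sum p (items_of m ?ow i - {b})" by (intro sum.cong) auto
    also have "\<dots> \<le> sum p (items_of m ow i)"
      using p by (intro sum_mono2) (auto simp: items_of_def)
    finally show ?thesis using True poor by (intro exI[of _ b]) simp
  next
    case False
    \<comment> \<open>Any other agent keeps her exception, since she can only lose an item.\<close>
    obtain g where g: "sum p (items_of m ow h - {g}) \<le> L" using inv \<open>h < n\<close> by (auto simp: auction_inv_def)
    have "sum ?p (items_of m ?ow h - {g}) = sum p (items_of m ?ow h - {g})"
      using False by (intro sum.cong) (auto simp: items_of_def)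
    also have "\<dots> \<le> sum p (items_of m ow h - {g})"
      using p False by (intro sum_mono2) (auto simp: items_of_def)
    finally show ?thesis using g by (intro exI[of _ g]) simp
  qed
  have 3: "4 * u (?ow j) j' * (?p j + 4) \<le> 5 * u (?ow j) j * (?p j' + 4)"
    if j: "j < m" "0 < ?p j" "j' < m" for j j'
  proof (cases "j = b")
    case True
    have "u i j' * real_of_int (4 * (raise (p b) + 4)) \<le> u i j' * real_of_int (5 * (p b + 4))"
      using u[OF i j(3)] raise(3) by (intro mult_left_mono) (simp_all only: of_int_le_iff)
    also have "\<dots> = 5 * (u i j' * (p b + 4))" by simp
    also have "\<dots> \<le> 5 * (u i b * (p j' + 4))"
      using best j by (intro mult_left_mono) (auto simp: best_item_def)
    also have "\<dots> \<le> 5 * (u i b * (?p j' + 4))"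
      using u[OF i b] le[of j'] by (intro mult_left_mono) simp_all
    finally show ?thesis using True by (simp add: algebra_simps)
  next
    case False
    have "4 * u (ow j) j' * (p j + 4) \<le> 5 * u (ow j) j * (p j' + 4)"
      using inv j False by (simp add: auction_inv_def)
    also have "\<dots> \<le> 5 * u (ow j) j * (?p j' + 4)"
      using u[OF p(2)[OF j(1)] j(1)] le[of j'] by (intro mult_left_mono) simp_all
    finally show ?thesis using False by simp
  qed
  show ?thesis unfolding auction_inv_def using 1 2 3 by blast
qed

section \<open>Prices stay bounded by Hall's condition\<close>

text \<open>Pigeonhole: the \<open>m\<close> disjoint intervals from \<open>X * Y ^ t\<close> to
  \<open>X * Y ^ Suc t\<close> all lie below \<open>P b\<close>, so only the items other than
  \<open>b\<close> can occupy them, and one interval remains empty.\<close>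

lemma price_gap:
  fixes P :: "nat \<Rightarrow> real"
  assumes "b < m" "X * Y ^ m < P b" "0 \<le> X" "1 \<le> Y"
  obtains t where "t < m" "\<And>j. j < m \<Longrightarrow> X * Y ^ t < P j \<Longrightarrow> X * Y ^ Suc t < P j"
proof -
  have mono: "X * Y ^ t \<le> X * Y ^ t'" if "t \<le> t'" for t t'
    using assms that by (intro mult_left_mono power_increasing)
  have "\<exists>t<m. \<forall>j<m. X * Y ^ t < P j \<longrightarrow> X * Y ^ Suc t < P j"
  proof (rule ccontr)
    assume "\<not> ?thesis"
    then have "\<forall>t<m. \<exists>j. j < m \<and> X * Y ^ t < P j \<and> P j \<le> X * Y ^ Suc t" by (meson not_less)
    then obtain f where f: "\<And>t. t < m \<Longrightarrow> f t < m \<and> X * Y ^ t < P (f t) \<and> P (f t) \<le> X * Y ^ Suc t"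
      by metis
    have ne: "f t \<noteq> f t'" if "t < t'" "t' < m" for t t'
      using f[of t] f[of t'] mono[of "Suc t" t'] that by force
    have "inj_on f {..<m}"
      by (rule inj_onI) (metis ne lessThan_iff nat_neq_iff)
    moreover have "f t \<noteq> b" if "t < m" for t
      using f[OF that] mono[of "Suc t" m] assms(2) that by auto
    then have "f ` {..<m} \<subseteq> {..<m} - {b}" using f by auto
    ultimately have "card {..<m} \<le> card ({..<m} - {b})" by (intro card_inj_on_le) auto
    then show False using assms(1) by (simp add: card_Diff_singleton)
  qed
  then show thesis using that by blast
qed

text \<open>Otherwise let \<open>H\<close> be the items above a price gap of factor
  \<open>2 * W\<close>. Their owners are distinct, each \<open>p j\<close> in \<open>H\<close>
  exceeding \<open>L\<close>, and the poor agent \<open>i\<close> is not among them. All these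
  agents value only items in \<open>H\<close>, so the matching \<open>f\<close> injects
  \<open>card H + 1\<close> agents into \<open>H\<close>.\<close>

lemma best_item_price_le:
  fixes W :: real
  assumes inv: "auction_inv n m u L p ow" and i: "i < n" and poor: "sum p (items_of m ow i) < L"
    and best: "best_item m u p i b" and u: "\<And>i j. i < n \<Longrightarrow> j < m \<Longrightarrow> 0 \<le> u i j"
    and f: "inj_on f {..<n}" "\<And>i. i < n \<Longrightarrow> f i < m \<and> 0 < u i (f i)"
    and W: "1 \<le> W" "\<And>i j j'. i < n \<Longrightarrow> j < m \<Longrightarrow> j' < m \<Longrightarrow> 0 < u i j' \<Longrightarrow> u i j \<le> W * u i j'"
    and L: "0 \<le> L"
  shows "p b + 4 \<le> (L + 4) * (2 * W) ^ m"
proof (rule ccontr)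
  assume "\<not> ?thesis"
  then have high: "(L + 4) * (2 * W) ^ m < real_of_int (p b + 4)" by simp
  have b: "b < m" using best by (simp add: best_item_def)
  have p: "0 \<le> p j" "ow j < n" if "j < m" for j using inv that by (auto simp: auction_inv_def)
  obtain t where t: "t < m" "\<And>j. j < m \<Longrightarrow> (L + 4) * (2 * W) ^ t < real_of_int (p j + 4) \<Longrightarrow>
      (L + 4) * (2 * W) ^ Suc t < real_of_int (p j + 4)"
    using price_gap[of b m "L + 4" "2 * W" "\<lambda>j. real_of_int (p j + 4)"] b high W L by auto
  define H where "H = {j. j < m \<and> (L + 4) * (2 * W) ^ t < real_of_int (p j + 4)}"
  have fin: "finite H" by (simp add: H_def)
  have one: "1 \<le> (2 * W) ^ k" for k using W by (intro one_le_power) simp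
  have pL: "L < p j" if "j \<in> H" for j
  proof -
    have "(real_of_int L + 4) * 1 \<le> (real_of_int L + 4) * (2 * W) ^ t"
      using one[of t] L by (intro mult_left_mono) auto
    then show ?thesis using that by (simp add: H_def)
  qed
  \<comment> \<open>An agent with a nearly best item in \<open>H\<close> values nothing outside
    \<open>H\<close>: her values differ by a factor of at most \<open>W\<close>, so
    \<open>j'\<close> would have too good a ratio if it were below the gap.\<close>
  have up: "j' \<in> H" if j: "j \<in> H" and h: "h < n" and j': "j' < m" "0 < u h j'"
    and mbb: "4 * u h j' * (p j + 4) \<le> 5 * u h j * (p j' + 4)" for h j j'
  proof -
    have jm: "j < m" using j by (simp add: H_def)
    have "4 * u h j' * (p j + 4) \<le> 5 * (W * u h j') * (p j' + 4)"
    proof -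
      have "5 * u h j * (p j' + 4) \<le> 5 * (W * u h j') * (p j' + 4)"
        using W(2)[OF h jm j'] p(1)[OF j'(1)] by (intro mult_right_mono mult_left_mono) auto
      then show ?thesis using mbb by linarith
    qed
    then have "u h j' * (4 * (p j + 4)) \<le> u h j' * (5 * W * (p j' + 4))"
      by (simp add: algebra_simps)
    then have "4 * real_of_int (p j + 4) \<le> 5 * W * (p j' + 4)" using j' by (simp add: mult_le_cancel_left_pos)
    note bound = this
    define Z where "Z = (L + 4) * (2 * W) ^ t"
    have "(L + 4) * (2 * W) ^ Suc t = 2 * W * Z" unfolding Z_def power_Suc by (simp only: mult_ac)
    moreover have "(L + 4) * (2 * W) ^ Suc t < real_of_int (p j + 4)"
      using t(2)[of j] j unfolding H_def mem_Collect_eq by blast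
    ultimately have "2 * W * Z < real_of_int (p j + 4)" by (simp only:)
    then have "4 * (2 * W * Z) < 4 * real_of_int (p j + 4)" by simp
    from order_less_le_trans[OF this bound] have "4 * (2 * W * Z) < 5 * W * (p j' + 4)" .
    \<comment> \<open>The gap factor \<open>2 * W\<close> against the loss \<open>5/4 * W\<close>
      leaves \<open>8/5\<close>, which puts \<open>j'\<close> above the lower end \<open>Z\<close>
      of the gap.\<close>
    then have "W * (8 * Z) < W * (5 * (p j' + 4))" by (simp add: algebra_simps)
    then have "8 * Z < 5 * real_of_int (p j' + 4)" using W(1) by (simp add: mult_less_cancel_left_pos)
    moreover have "0 \<le> Z" unfolding Z_def using L one[of t] by (intro mult_nonneg_nonneg) auto
    moreover have "x < y" if "8 * x < 5 * y" "0 \<le> x" for x y :: real using that by linarith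
    ultimately have "Z < real_of_int (p j' + 4)" by blast
    then show ?thesis using j' by (simp only: H_def Z_def mem_Collect_eq)
  qed
  have posH: "0 < p j" if "j \<in> H" for j using pL[OF that] L by linarith
  have fH: "f (ow j) \<in> H" if "j \<in> H" for j
  proof -
    have j: "j < m" using that by (simp add: H_def)
    have fj: "f (ow j) < m" "0 < u (ow j) (f (ow j))" using f(2)[OF p(2)[OF j]] by auto
    have "4 * u (ow j) (f (ow j)) * (p j + 4) \<le> 5 * u (ow j) j * (p (f (ow j)) + 4)"
      using inv j posH[OF that] fj(1) unfolding auction_inv_def by blast
    then show ?thesis by (rule up[OF that p(2)[OF j] fj])
  qed
  have "(L + 4) * (2 * W) ^ t \<le> (L + 4) * (2 * W) ^ m"
    using W L t by (intro mult_left_mono power_increasing) auto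
  then have bH: "b \<in> H" using high b by (simp add: H_def)
  have fi: "f i \<in> H"
  proof (rule up[OF bH i])
    have fm: "f i < m" "0 < u i (f i)" using f(2)[OF i] by auto
    then show "f i < m" "0 < u i (f i)" by auto
    have "u i (f i) * (p b + 4) \<le> u i b * (p (f i) + 4)" using best fm by (simp add: best_item_def)
    moreover have "0 \<le> u i b * (p (f i) + 4)" using u[OF i b] p(1)[OF fm(1)] by simp
    ultimately show "4 * u i (f i) * (p b + 4) \<le> 5 * u i b * (p (f i) + 4)" by simp
  qed
  have inj: "inj_on ow H"
  proof (rule inj_onI, rule ccontr)
    fix j j' assume jj: "j \<in> H" "j' \<in> H" "ow j = ow j'" "j \<noteq> j'"
    then have m: "j < m" "j' < m" by (auto simp: H_def)
    obtain g where g: "sum p (items_of m ow (ow j) - {g}) \<le> L"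
      using inv p(2)[OF m(1)] by (auto simp: auction_inv_def)
    \<comment> \<open>Two items of one owner cannot both be the exception \<open>g\<close>, so one
      of them counts towards \<open>L\<close>.\<close>
    obtain k where k: "k \<in> H" "k \<noteq> g" "ow k = ow j" using jj by metis
    have "p k \<le> sum p (items_of m ow (ow j) - {g})"
      using k p by (intro member_le_sum) (auto simp: items_of_def H_def)
    then show False using g pL[OF k(1)] by linarith
  qed
  have ni: "i \<notin> ow ` H"
  proof
    assume "i \<in> ow ` H"
    then obtain j where j: "j \<in> H" "ow j = i" by auto
    then have "p j \<le> sum p (items_of m ow i)"
      using p by (intro member_le_sum) (auto simp: items_of_def H_def)
    then show False using poor pL[OF j(1)] by linarith
  qed
  have sub: "insert i (ow ` H) \<subseteq> {..<n}" using i p(2) by (auto simp: H_def)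
  have "card (insert i (ow ` H)) \<le> card H"
    using fin fH fi inj_on_subset[OF f(1) sub] by (intro card_inj_on_le[of f]) auto
  then show False using ni fin card_image[OF inj] by simp
qed

section \<open>Bounding products of prices and of values\<close>

text \<open>AM-GM, obtained by multiplying the inequalities \<open>x \<le> exp (x - 1)\<close> for
  \<open>x = c i / t\<close>.\<close>

lemma prod_le_power_if_sum_le:
  fixes c :: "'a \<Rightarrow> real" and t :: real
  assumes "finite A" "\<And>i. i \<in> A \<Longrightarrow> 0 \<le> c i" "0 < t" "sum c A \<le> t * card A"
  shows "prod c A \<le> t ^ card A"
proof -
  have "(\<Prod>i\<in>A. c i / t) \<le> (\<Prod>i\<in>A. exp (c i / t - 1))"
  proof (rule prod_mono)
    fix i assume "i \<in> A"
    show "0 \<le> c i / t \<and> c i / t \<le> exp (c i / t - 1)"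
      using assms \<open>i \<in> A\<close> exp_ge_add_one_self[of "c i / t - 1"] by simp
  qed
  also have "\<dots> = exp (sum c A / t - card A)"
    using assms(1) by (simp add: exp_sum[symmetric] sum_subtractf sum_divide_distrib)
  also have "\<dots> \<le> 1" using assms by (simp add: field_simps)
  finally have "prod c A / t ^ card A \<le> 1" by (simp add: prod_dividef)
  then show ?thesis using assms(3) by (simp add: field_simps)
qed

text \<open>Each \<open>q j\<close> is at most the product of all \<open>max (q j) 1\<close>.
  Trading the sum for this product separates the expensive items, which may be unbounded, from a
  factor fit for AM-GM.\<close>

lemma sum_add_le_prod_times:
  fixes q :: "'a \<Rightarrow> real" and D :: real
  assumes "finite S" "0 \<le> D"
  shows "sum q S + D \<le> (\<Prod>j\<in>S. max (q j) 1) * (card S + D)"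
proof -
  let ?w = "\<lambda>j. max (q j) 1"
  have ge: "1 \<le> prod ?w T" for T by (rule prod_ge_1) auto
  have "q j \<le> prod ?w S" if "j \<in> S" for j
  proof -
    have "prod ?w S = ?w j * prod ?w (S - {j})" using assms that by (simp add: prod.remove)
    moreover have "?w j * 1 \<le> ?w j * prod ?w (S - {j})" by (intro mult_left_mono ge) auto
    ultimately show ?thesis by simp
  qed
  then have "sum q S \<le> card S * prod ?w S" using sum_bounded_above[of S q "prod ?w S"] by simp
  moreover have "1 * D \<le> prod ?w S * D" using assms by (intro mult_right_mono ge)
  ultimately show ?thesis by (simp add: algebra_simps)
qed

text \<open>In units of \<open>L\<close>, each bundle is at most the product of the weights
  \<open>w\<close> of its left-out items, times their number plus the remaining price
  \<open>D i\<close>. The weights multiply to at most the spendings, and AM-GM bounds the other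
  factors because they sum up to at most \<open>21/10 * n\<close>.\<close>

lemma prod_items_price_le:
  assumes inv: "auction_inv n m u L p ow" and rich: "\<And>i. i < n \<Longrightarrow> L \<le> sum p (items_of m ow i)"
    and L: "L = 40 * int m" and pos: "0 < m" "1 \<le> n" and A: "\<And>j. j < m \<Longrightarrow> A j < n"
  shows "(\<Prod>i<n. \<Sum>j\<in>items_of m A i. real_of_int (p j + 4)) \<le>
    (21 / 10) ^ n * (\<Prod>i<n. real_of_int (sum p (items_of m ow i)))"
proof -
  have p: "0 \<le> p j" "ow j < n" if "j < m" for j using inv that by (auto simp: auction_inv_def)
  have "\<forall>h<n. \<exists>g. sum p (items_of m ow h - {g}) \<le> L" using inv by (auto simp: auction_inv_def)
  then obtain g where g: "\<And>h. h < n \<Longrightarrow> sum p (items_of m ow h - {g h}) \<le> L" by metis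
  \<comment> \<open>The exception \<open>g h\<close> need not belong to \<open>h\<close>; only
    agents who own theirs are relevant, and on them \<open>g\<close> is injective.\<close>
  define N where "N = {h. h < n \<and> g h \<in> items_of m ow h}"
  define G where "G = g ` N"
  have N: "finite N" "N \<subseteq> {..<n}" by (auto simp: N_def)
  have injg: "inj_on g N" by (rule inj_onI) (auto simp: N_def items_of_def)
  have G: "G \<subseteq> {..<m}" by (auto simp: G_def N_def items_of_def)
  then have finG: "finite G" using finite_subset by blast
  define q where "q j = real_of_int (p j) / L" for j
  define w where "w j = max (q j) 1" for j
  \<comment> \<open>The initial price 4 counts here for every item, including those in
    \<open>G\<close>.\<close>
  define D where "D i = ((\<Sum>j\<in>items_of m A i - G. real_of_int (p j)) + 4 * card (items_of m A i)) / L" for i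
  have Lpos: "0 < L" using L pos by simp
  have D: "0 \<le> D i" for i
    unfolding D_def using p Lpos by (intro divide_nonneg_pos add_nonneg_nonneg sum_nonneg) (auto simp: items_of_def)
  have split: "(\<Sum>j\<in>items_of m A i. real_of_int (p j + 4)) = L * (sum q (items_of m A i \<inter> G) + D i)" for i
  proof -
    have "(\<Sum>j\<in>items_of m A i. real_of_int (p j + 4)) = (\<Sum>j\<in>items_of m A i. real_of_int (p j)) + 4 * card (items_of m A i)"
      by (simp add: sum.distrib)
    also have "(\<Sum>j\<in>items_of m A i. real_of_int (p j)) =
      (\<Sum>j\<in>items_of m A i \<inter> G. real_of_int (p j)) + (\<Sum>j\<in>items_of m A i - G. real_of_int (p j))"
      by (rule sum.Int_Diff) simp
    finally show ?thesis
      using Lpos by (simp add: D_def q_def sum_divide_distrib[symmetric] field_simps)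
  qed
  have disj: "(\<Union>i<n. items_of m A i \<inter> G) = G" using G A by (auto simp: items_of_def)
  have all: "(\<Union>i<n. items_of m A i) = {..<m}" using A by (auto simp: items_of_def)
  have rest: "(\<Union>i<n. items_of m A i - G) = {..<m} - G" using A by (auto simp: items_of_def)
  have 1: "(\<Prod>i<n. \<Prod>j\<in>items_of m A i \<inter> G. w j) \<le> (\<Prod>i<n. real_of_int (sum p (items_of m ow i)) / L)"
  proof -
    have rich': "1 \<le> real_of_int (sum p (items_of m ow i)) / L" if "i < n" for i
      using rich[OF that] Lpos by (simp add: of_int_sum[symmetric] del: of_int_sum)
    have "(\<Prod>i<n. \<Prod>j\<in>items_of m A i \<inter> G. w j) = prod w (\<Union>i<n. items_of m A i \<inter> G)"
      by (rule prod.UNION_disjoint[symmetric]) (auto simp: items_of_def)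
    also have "\<dots> = (\<Prod>h\<in>N. w (g h))" unfolding disj unfolding G_def using injg by (simp add: prod.reindex)
    also have "\<dots> \<le> (\<Prod>h\<in>N. real_of_int (sum p (items_of m ow h)) / L)"
    proof (rule prod_mono)
      fix h assume h: "h \<in> N"
      have "p (g h) \<le> sum p (items_of m ow h)"
        using h p by (intro member_le_sum) (auto simp: N_def items_of_def)
      then have "q (g h) \<le> real_of_int (sum p (items_of m ow h)) / L"
        unfolding q_def using Lpos by (intro divide_right_mono) (auto simp: of_int_sum[symmetric] simp del: of_int_sum)
      then show "0 \<le> w (g h) \<and> w (g h) \<le> real_of_int (sum p (items_of m ow h)) / L"
        using rich' h by (auto simp: w_def N_def)
    qed
    \<comment> \<open>Nobody is poor, so the additional factors are at least 1.\<close>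
    also have "\<dots> \<le> (\<Prod>h<n. real_of_int (sum p (items_of m ow h)) / L)"
    proof (rule prod_mono2)
      fix h assume "h \<in> N"
      then have "1 \<le> real_of_int (sum p (items_of m ow h)) / L" using rich' by (simp add: N_def)
      then show "0 \<le> real_of_int (sum p (items_of m ow h)) / L" by linarith
    qed (use N rich' in auto)
    finally show ?thesis .
  qed
  have 2: "(\<Prod>i<n. real (card (items_of m A i \<inter> G)) + D i) \<le> (21 / 10) ^ n"
  proof -
    have "(\<Sum>i<n. real (card (items_of m A i \<inter> G))) = real (card (\<Union>i<n. items_of m A i \<inter> G))"
      by (subst card_UN_disjoint) (auto simp: items_of_def)
    also have "\<dots> \<le> n" unfolding disj unfolding G_def
      using card_image_le[OF N(1), of g] card_mono[OF _ N(2)] by simp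
    finally have c: "(\<Sum>i<n. real (card (items_of m A i \<inter> G))) \<le> n" .
    have "(\<Sum>i<n. \<Sum>j\<in>items_of m A i - G. real_of_int (p j)) = (\<Sum>j\<in>{..<m} - G. real_of_int (p j))"
      unfolding rest[symmetric] by (rule sum.UNION_disjoint[symmetric]) (auto simp: items_of_def)
    also have "\<dots> = (\<Sum>h<n. \<Sum>j\<in>items_of m ow h - G. real_of_int (p j))"
    proof -
      have "{..<m} - G = (\<Union>h<n. items_of m ow h - G)" using p(2) by (auto simp: items_of_def)
      then show ?thesis by (simp only:) (rule sum.UNION_disjoint, auto simp: items_of_def)
    qed
    also have "\<dots> \<le> (\<Sum>h<n. real_of_int L)"
    proof (rule sum_mono)
      fix h assume h: "h \<in> {..<n}"
      have "sum p (items_of m ow h - G) \<le> sum p (items_of m ow h - {g h})"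
        using p h by (intro sum_mono2) (auto simp: items_of_def G_def N_def)
      then show "(\<Sum>j\<in>items_of m ow h - G. real_of_int (p j)) \<le> real_of_int L"
        using g[of h] h by (simp add: of_int_sum[symmetric] del: of_int_sum)
    qed
    finally have s: "(\<Sum>i<n. \<Sum>j\<in>items_of m A i - G. real_of_int (p j)) \<le> n * real_of_int L" by simp
    have "(\<Sum>i<n. real (card (items_of m A i))) = real (card (\<Union>i<n. items_of m A i))"
      by (subst card_UN_disjoint) (auto simp: items_of_def)
    then have k: "(\<Sum>i<n. real (card (items_of m A i))) = m" unfolding all by simp
    have "sum D {..<n} = ((\<Sum>i<n. \<Sum>j\<in>items_of m A i - G. real_of_int (p j)) + 4 * m) / L"
      unfolding D_def by (simp add: sum_divide_distrib[symmetric] sum.distrib sum_distrib_left[symmetric] k)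
    also have "\<dots> \<le> (n * real_of_int L + 4 * m) / L"
      using s Lpos by (intro divide_right_mono) auto
    also have "\<dots> = n + 1 / 10" using L pos by (simp add: field_simps)
    \<comment> \<open>At most \<open>n\<close> left-out items, \<open>n\<close> from the other
      \<open>p j\<close>, and \<open>1/10\<close> from the initial prices as
      \<open>4 * m = L / 10\<close>; this last term is absorbed by \<open>1 \<le> n\<close>.\<close>
    finally have "(\<Sum>i<n. real (card (items_of m A i \<inter> G)) + D i) \<le> 21 / 10 * card {..<n}"
      using c pos by (simp add: sum.distrib)
    from prod_le_power_if_sum_le[OF _ _ _ this] D show ?thesis by auto
  qed
  have "(\<Prod>i<n. \<Sum>j\<in>items_of m A i. real_of_int (p j + 4)) = L ^ n * (\<Prod>i<n. sum q (items_of m A i \<inter> G) + D i)"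
    unfolding split by (simp add: prod.distrib)
  also have "\<dots> \<le> L ^ n * (\<Prod>i<n. (\<Prod>j\<in>items_of m A i \<inter> G. w j) * (card (items_of m A i \<inter> G) + D i))"
  proof (intro mult_left_mono prod_mono conjI)
    fix i
    show "0 \<le> sum q (items_of m A i \<inter> G) + D i"
      using D[of i] p Lpos by (intro add_nonneg_nonneg sum_nonneg) (auto simp: q_def items_of_def)
    show "sum q (items_of m A i \<inter> G) + D i \<le>
        (\<Prod>j\<in>items_of m A i \<inter> G. w j) * (card (items_of m A i \<inter> G) + D i)"
      unfolding w_def using D by (intro sum_add_le_prod_times) auto
  qed (use Lpos in auto)
  also have "\<dots> \<le> L ^ n * ((\<Prod>i<n. real_of_int (sum p (items_of m ow i)) / L) * (21 / 10) ^ n)"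
    unfolding prod.distrib using 1 2 Lpos D
    by (intro mult_left_mono mult_mono) (auto intro!: prod_nonneg divide_nonneg_pos sum_nonneg simp: w_def add_nonneg_nonneg items_of_def p)
  also have "\<dots> = (21 / 10) ^ n * (\<Prod>i<n. real_of_int (sum p (items_of m ow i)))"
    using Lpos by (simp add: prod_dividef)
  finally show ?thesis by simp
qed

text \<open>With \<open>B i\<close> the best ratio of agent \<open>i\<close>, a value under
  \<open>A\<close> is at most \<open>B i\<close> times the price, and the current value is at least
  \<open>4/5 * B i\<close> times the spending. The factors \<open>B i\<close> cancel, and
  \<open>21/10 * 5/4 = 21/8\<close>.\<close>

lemma prod_items_value_le:
  assumes inv: "auction_inv n m u L p ow" and rich: "\<And>i. i < n \<Longrightarrow> L \<le> sum p (items_of m ow i)"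
    and L: "L = 40 * int m" and pos: "0 < m" "1 \<le> n" and A: "\<And>j. j < m \<Longrightarrow> A j < n"
    and u: "\<And>i j. i < n \<Longrightarrow> j < m \<Longrightarrow> 0 \<le> u i j"
  shows "(\<Prod>i<n. \<Sum>j\<in>items_of m A i. u i j) \<le> (21 / 8) ^ n * (\<Prod>i<n. \<Sum>j\<in>items_of m ow i. u i j)"
proof -
  have p: "0 \<le> p j" "ow j < n" if "j < m" for j using inv that by (auto simp: auction_inv_def)
  define B where "B i = Max ((\<lambda>j. u i j / (p j + 4)) ` {..<m})" for i
  have Bge: "u i j \<le> B i * (p j + 4)" if "j < m" for i j
  proof -
    have "u i j / (p j + 4) \<le> B i" unfolding B_def using that by (intro Max_ge) auto
    then show ?thesis using p(1)[OF that] by (simp add: field_simps)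
  qed
  have Bex: "\<exists>j<m. B i = u i j / (p j + 4)" for i
  proof -
    have "B i \<in> (\<lambda>j. u i j / (p j + 4)) ` {..<m}" unfolding B_def using pos by (intro Max_in) auto
    then show ?thesis by auto
  qed
  have B0: "0 \<le> B i" if "i < n" for i using Bex[of i] u[OF that] p(1) by fastforce
  \<comment> \<open>An item without a bid may have a poor ratio, but it contributes nothing to the
    spending.\<close>
  have Ble: "4 / 5 * (B i * p j) \<le> u i j" if i: "i < n" and j: "j \<in> items_of m ow i" for i j
  proof (cases "p j = 0")
    case True
    then show ?thesis using u[OF i] j by (simp add: items_of_def)
  next
    case False
    have jm: "j < m" "ow j = i" using j by (auto simp: items_of_def)
    obtain k where k: "k < m" "B i = u i k / (p k + 4)" using Bex by blast
    have "4 * u i k * (p j + 4) \<le> 5 * u i j * (p k + 4)"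
      using inv jm k False p(1)[OF jm(1)] by (auto simp: auction_inv_def)
    then have "4 / 5 * (B i * (p j + 4)) \<le> u i j"
      using p(1)[OF k(1)] by (simp add: k(2) field_simps)
    moreover have "4 / 5 * (B i * p j) \<le> 4 / 5 * (B i * (p j + 4))"
      using B0[OF i] by (intro mult_left_mono) auto
    ultimately show ?thesis by linarith
  qed
  have "(\<Prod>i<n. \<Sum>j\<in>items_of m A i. u i j) \<le> (\<Prod>i<n. B i * (\<Sum>j\<in>items_of m A i. real_of_int (p j + 4)))"
    using u Bge unfolding sum_distrib_left
    by (intro prod_mono conjI sum_nonneg sum_mono) (auto simp: items_of_def)
  also have "\<dots> = prod B {..<n} * (\<Prod>i<n. \<Sum>j\<in>items_of m A i. real_of_int (p j + 4))"
    by (rule prod.distrib)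
  also have "\<dots> \<le> prod B {..<n} * ((21 / 10) ^ n * (\<Prod>i<n. real_of_int (sum p (items_of m ow i))))"
    using B0 by (intro mult_left_mono prod_items_price_le[OF inv rich L pos A] prod_nonneg) auto
  also have "\<dots> = (21 / 8) ^ n * (\<Prod>i<n. 4 / 5 * (B i * real_of_int (sum p (items_of m ow i))))"
  proof -
    have "(21 / 10 :: real) ^ n = (21 / 8) ^ n * (4 / 5) ^ n" by (simp add: power_mult_distrib[symmetric])
    then show ?thesis by (simp only: prod.distrib prod_constant card_lessThan mult.assoc mult.left_commute mult.commute)
  qed
  also have "\<dots> \<le> (21 / 8) ^ n * (\<Prod>i<n. \<Sum>j\<in>items_of m ow i. u i j)"
  proof (intro mult_left_mono prod_mono conjI)
    fix i assume i: "i \<in> {..<n}"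
    have "0 \<le> sum p (items_of m ow i)" using p by (intro sum_nonneg) (auto simp: items_of_def)
    then have "0 \<le> real_of_int (sum p (items_of m ow i))" by (simp only: of_int_0_le_iff)
    then show "0 \<le> 4 / 5 * (B i * real_of_int (sum p (items_of m ow i)))" using B0 i by simp
    have "4 / 5 * (B i * real_of_int (sum p (items_of m ow i))) = (\<Sum>j\<in>items_of m ow i. 4 / 5 * (B i * p j))"
      by (simp add: sum_distrib_left)
    also have "\<dots> \<le> (\<Sum>j\<in>items_of m ow i. u i j)" using Ble i by (intro sum_mono) auto
    finally show "4 / 5 * (B i * real_of_int (sum p (items_of m ow i))) \<le> (\<Sum>j\<in>items_of m ow i. u i j)" .
  qed simp
  finally show ?thesis .
qed

section \<open>The program\<close>

abbreviation Var :: "vname \<Rightarrow> aexp" where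
  "Var x \<equiv> Cell x (Const 0)"

text \<open>Initially all cells of the program's own variables are \<open>0\<close>: no item has a bid, and all items are
  owned by agent \<open>0\<close>, for whom they do not count in \<open>s\<close> before a bid. The variable \<open>e\<close> becomes a number
  such that all numerators and denominators are below \<open>d = 2\<^sup>e\<close>.\<close>

definition grow_cmd :: com where
  "grow_cmd = Seq (Assign ''d'' (Const 0) (Plus (Var ''d'') (Var ''d'')))
     (Assign ''e'' (Const 0) (Plus (Var ''e'') (Const 1)))"

text \<open>After doubling \<open>d\<close>, the same entry is examined again, so no inner loop is
  required.\<close>

definition scan_cmd :: com where
  "scan_cmd = While (Less (Var ''k'') (Times (Var ''n'') (Var ''m'')))
     (If (Neg (Less (Cell ''num'' (Var ''k'')) (Var ''d''))) grow_cmd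
     (If (Neg (Less (Cell ''den'' (Var ''k'')) (Var ''d''))) grow_cmd
        (Assign ''k'' (Const 0) (Plus (Var ''k'') (Const 1)))))"

text \<open>Ratios are compared by clearing denominators; the large products occur only in the
  test.\<close>

definition search_cmd :: com where
  "search_cmd =
     (let entry = (\<lambda>x j. Cell x (Plus (Times (Var ''i'') (Var ''m'')) (Var j)));
          price = (\<lambda>j. Plus (Cell ''p'' (Var j)) (Const 4)) in
      Seq (Assign ''b'' (Const 0) (Const 0)) (Seq (Assign ''j'' (Const 0) (Const 0))
        (While (Less (Var ''j'') (Var ''m''))
          (Seq (If (Less (Times (Times (entry ''num'' ''b'') (entry ''den'' ''j'')) (price ''j''))
                         (Times (Times (entry ''num'' ''j'') (entry ''den'' ''b'')) (price ''b'')))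
                 (Assign ''b'' (Const 0) (Var ''j'')) Skip)
            (Assign ''j'' (Const 0) (Plus (Var ''j'') (Const 1)))))))"

text \<open>The old price is subtracted before the raised one is added, which is also right if the
  bidder already owns the item. Resetting \<open>i\<close> to 0 is necessary as the previous owner
  may have become poor.\<close>

definition bid_cmd :: com where
  "bid_cmd =
     (let owner = Cell ''o'' (Var ''b''); price = Cell ''p'' (Var ''b'') in
      Seq (Assign ''s'' owner (Minus (Cell ''s'' owner) price))
     (Seq (Assign ''p'' (Var ''b'') (Plus price (Plus (Divide price (Const 4)) (Const 1))))
     (Seq (Assign ''o'' (Var ''b'') (Var ''i''))
     (Seq (Assign ''s'' (Var ''i'') (Plus (Cell ''s'' (Var ''i'')) price))
     (Seq (Assign ''c'' (Const 0) (Plus (Var ''c'') (Const 1)))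
          (Assign ''i'' (Const 0) (Const 0)))))))"

text \<open>Agents below \<open>i\<close> are known not to be poor. The cap on the bid counter
  \<open>c\<close> forces termination when the optimum is 0; it exceeds by 1 what is possible
  otherwise.\<close>

definition auction_cmd :: com where
  "auction_cmd = While
     (Conj (Less (Var ''i'') (Var ''n''))
       (Less (Var ''c'') (Plus (Times (Times (Const 6) (Var ''m''))
         (Plus (Const 6) (Times (Var ''m'') (Plus (Plus (Var ''e'') (Var ''e'')) (Const 2))))) (Const 1))))
     (If (Less (Cell ''s'' (Var ''i'')) (Times (Const 40) (Var ''m''))) (Seq search_cmd bid_cmd)
       (Assign ''i'' (Const 0) (Plus (Var ''i'') (Const 1))))"

definition output_cmd :: com where
  "output_cmd = Seq (Assign ''j'' (Const 0) (Const 0)) (While (Less (Var ''j'') (Var ''m''))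
     (Seq (Assign ''x'' (Plus (Times (Cell ''o'' (Var ''j'')) (Var ''m'')) (Var ''j'')) (Const 1))
       (Assign ''j'' (Const 0) (Plus (Var ''j'') (Const 1)))))"

definition nsw_cmd :: com where
  "nsw_cmd = Seq (Assign ''d'' (Const 0) (Const 1)) (Seq scan_cmd (Seq auction_cmd output_cmd))"

text \<open>500 is a generous bound on the sizes of all expressions, with each constant weighing at
  most 7.\<close>

lemma additive_com_nsw_cmd: "additive_com 500 nsw_cmd"
proof -
  have "bit_size 0 \<le> 7" "bit_size 1 \<le> 7" "bit_size 2 \<le> 7" "bit_size 4 \<le> 7" "bit_size 6 \<le> 7" "bit_size 40 \<le> 7"
    using bit_size_le[of _ 6] by auto
  then show ?thesis
    by (simp add: nsw_cmd_def grow_cmd_def scan_cmd_def search_cmd_def bid_cmd_def auction_cmd_def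
        output_cmd_def Let_def)
qed

section \<open>Correctness of the input scan\<close>

definition has_inputs :: "nat \<Rightarrow> nat \<Rightarrow> (nat \<Rightarrow> nat \<Rightarrow> rat) \<Rightarrow> state \<Rightarrow> bool" where
  "has_inputs n m v s \<longleftrightarrow> s ''n'' = input_state n m v ''n'' \<and> s ''m'' = input_state n m v ''m'' \<and>
     s ''num'' = input_state n m v ''num'' \<and> s ''den'' = input_state n m v ''den''"

lemma index_less: "i * m + j < n * m" if "i < n" "j < m" for i j n m :: nat
proof -
  have "i * m + j < Suc i * m" using that by simp
  also have "\<dots> \<le> n * m" using that by (intro mult_right_mono) auto
  finally show ?thesis .
qed

lemma has_inputs_simps:
  assumes "has_inputs n m v s"
  shows "s ''n'' 0 = int n" "s ''m'' 0 = int m"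
    and "k < n * m \<Longrightarrow> s ''num'' (int k) = fst (quotient_of (v (k div m) (k mod m)))"
    and "k < n * m \<Longrightarrow> s ''den'' (int k) = snd (quotient_of (v (k div m) (k mod m)))"
    and "i < n \<Longrightarrow> j < m \<Longrightarrow> s ''num'' (int i * int m + int j) = fst (quotient_of (v i j))"
    and "i < n \<Longrightarrow> j < m \<Longrightarrow> s ''den'' (int i * int m + int j) = snd (quotient_of (v i j))"
proof -
  show "s ''n'' 0 = int n" "s ''m'' 0 = int m"
    using assms by (auto simp: has_inputs_def input_state_def)
  show num: "s ''num'' (int k) = fst (quotient_of (v (k div m) (k mod m)))" if "k < n * m" for k
    using assms that by (auto simp: has_inputs_def input_state_def Let_def simp flip: of_nat_mult)
  show den: "s ''den'' (int k) = snd (quotient_of (v (k div m) (k mod m)))" if "k < n * m" for k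
    using assms that by (auto simp: has_inputs_def input_state_def Let_def simp flip: of_nat_mult)
  assume "i < n" "j < m"
  then show "s ''num'' (int i * int m + int j) = fst (quotient_of (v i j))"
     "s ''den'' (int i * int m + int j) = snd (quotient_of (v i j))"
    using num[of "i * m + j"] den[of "i * m + j"] index_less[of i n j m] by simp_all
qed

lemma bit_size_le_input_size:
  assumes "i < n" "j < m"
  shows "bit_size (fst (quotient_of (v i j))) \<le> input_size n m v"
    and "bit_size (snd (quotient_of (v i j))) \<le> input_size n m v"
proof -
  let ?f = "\<lambda>i j. bit_size (fst (quotient_of (v i j))) + bit_size (snd (quotient_of (v i j)))"
  have "?f i j \<le> (\<Sum>j<m. ?f i j)" using assms by (intro member_le_sum) auto
  also have "\<dots> \<le> (\<Sum>i<n. \<Sum>j<m. ?f i j)"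
    using assms member_le_sum[of i "{..<n}" "\<lambda>i. \<Sum>j<m. ?f i j"] by auto
  finally have "?f i j \<le> input_size n m v" by (simp add: input_size_def)
  then show "bit_size (fst (quotient_of (v i j))) \<le> input_size n m v"
    "bit_size (snd (quotient_of (v i j))) \<le> input_size n m v" by auto
qed

lemma bounded_input_state: "bounded_state (input_size n m v) (input_state n m v)"
proof -
  have *: "\<bar>int k\<bar> < 2 ^ input_size n m v" if "k \<le> n + m" for k
  proof (rule less_power_two_mono)
    show "\<bar>int k\<bar> < 2 ^ k" by (simp add: of_nat_less_two_power)
    show "k \<le> input_size n m v" using that by (simp add: input_size_def)
  qed
  have q: "\<bar>fst (quotient_of (v (nat k div m) (nat k mod m)))\<bar> < 2 ^ input_size n m v"
    "\<bar>snd (quotient_of (v (nat k div m) (nat k mod m)))\<bar> < 2 ^ input_size n m v"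
    if "0 \<le> k" "k < int (n * m)" for k
  proof -
    have "nat k < n * m" using that by (simp add: nat_less_iff)
    then have "0 < m" by (cases m) auto
    then have "nat k div m < n" "nat k mod m < m"
      using \<open>nat k < n * m\<close> by (auto simp: less_mult_imp_div_less)
    from bit_size_le_input_size[OF this, of v]
    show "\<bar>fst (quotient_of (v (nat k div m) (nat k mod m)))\<bar> < 2 ^ input_size n m v"
      "\<bar>snd (quotient_of (v (nat k div m) (nat k mod m)))\<bar> < 2 ^ input_size n m v"
      using less_power_two_mono less_two_power_bit_size by blast+
  qed
  show ?thesis
    unfolding bounded_state_def input_state_def Let_def using *[of n] *[of m] q by auto
qed

text \<open>The listed arrays are those that the auction expects to be zero at its start.\<close>

definition scan_inv :: "nat \<Rightarrow> nat \<Rightarrow> (nat \<Rightarrow> nat \<Rightarrow> rat) \<Rightarrow> state \<Rightarrow> bool" where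
  "scan_inv n m v s \<longleftrightarrow> has_inputs n m v s \<and>
     (\<forall>x\<in>{''p'', ''o'', ''s'', ''i'', ''c'', ''x''}. s x = (\<lambda>_. 0)) \<and>
     (\<exists>S k. S \<le> input_size n m v \<and> s ''e'' 0 = int S \<and> s ''d'' 0 = 2 ^ S \<and> s ''k'' 0 = int k \<and> k \<le> n * m \<and>
        (\<forall>l<k. s ''num'' (int l) < 2 ^ S \<and> s ''den'' (int l) < 2 ^ S))"

lemma exec_scan_cmd:
  assumes "scan_inv n m v s" "s ''k'' 0 = 0" "s ''e'' 0 = 0"
  shows "\<exists>k s' S. exec scan_cmd s k s' \<and> k \<le> 7 * (n * m + input_size n m v) + 1 \<and>
    has_inputs n m v s' \<and> (\<forall>x\<in>{''p'', ''o'', ''s'', ''i'', ''c'', ''x''}. s' x = (\<lambda>_. 0)) \<and>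
    S \<le> input_size n m v \<and> s' ''e'' 0 = int S \<and>
    (\<forall>i<n. \<forall>j<m. fst (quotient_of (v i j)) < 2 ^ S \<and> snd (quotient_of (v i j)) < 2 ^ S)"
proof -
  \<comment> \<open>Each iteration advances either \<open>k\<close> or \<open>e\<close>.\<close>
  define \<mu> where "\<mu> s = nat (int (n * m) - s ''k'' 0) + nat (int (input_size n m v) - s ''e'' 0)" for s :: state
  have "\<exists>k s'. exec scan_cmd s k s' \<and> k \<le> (5 + 2) * \<mu> s + 1 \<and> scan_inv n m v s' \<and>
     \<not> bval (Less (Var ''k'') (Times (Var ''n'') (Var ''m''))) s'"
    unfolding scan_cmd_def
  proof (rule exec_While)
    fix s assume inv: "scan_inv n m v s" and guard: "bval (Less (Var ''k'') (Times (Var ''n'') (Var ''m''))) s"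
    let ?b1 = "Neg (Less (Cell ''num'' (Var ''k'')) (Var ''d''))"
      and ?b2 = "Neg (Less (Cell ''den'' (Var ''k'')) (Var ''d''))"
      and ?adv = "Assign ''k'' (Const 0) (Plus (Var ''k'') (Const 1))"
    from inv obtain S k where S: "S \<le> input_size n m v" "s ''e'' 0 = int S" "s ''d'' 0 = 2 ^ S"
      "s ''k'' 0 = int k" "k \<le> n * m" "\<forall>l<k. s ''num'' (int l) < 2 ^ S \<and> s ''den'' (int l) < 2 ^ S"
      by (auto simp: scan_inv_def)
    have inp: "has_inputs n m v s" using inv by (simp add: scan_inv_def)
    have k: "k < n * m" using guard S has_inputs_simps[OF inp] by (simp flip: of_nat_mult)
    then have "0 < m" by (cases m) auto
    then have km: "k div m < n" "k mod m < m" using k by (auto simp: less_mult_imp_div_less)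
    have grow: "\<exists>s'. exec grow_cmd s (1 + 2) s' \<and> scan_inv n m v s' \<and> \<mu> s' < \<mu> s"
      if big: "2 ^ S \<le> q" "bit_size q \<le> input_size n m v" for q :: int
    proof -
      let ?s = "update (update s ''d'' 0 (s ''d'' 0 + s ''d'' 0)) ''e'' 0 (s ''e'' 0 + 1)"
      have "exec grow_cmd s (1 + 2) ?s"
        unfolding grow_cmd_def by (rule exec_Assign_Seq[OF exec_Assign_eq]) (simp add: update_def)
      \<comment> \<open>An entry that is at least \<open>2 ^ S\<close> has more than
        \<open>S\<close> binary digits, all counted in the input size.\<close>
      moreover have "Suc S \<le> input_size n m v"
      proof -
        have "(2::int) ^ S < 2 ^ (bit_size q - 1)"
        proof -
          have "\<bar>q\<bar> < 2 ^ (bit_size q - 1)"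
            using floorlog_leD[of 2 "nat \<bar>q\<bar>" "floorlog 2 (nat \<bar>q\<bar>)"] by (simp add: bit_size_def nat_less_iff)
          then show ?thesis using big by linarith
        qed
        then have "S < bit_size q - 1" by (simp add: power_strict_increasing_iff)
        then show ?thesis using big by simp
      qed
      then have "scan_inv n m v ?s"
        unfolding scan_inv_def using inv S
        by (auto simp: scan_inv_def has_inputs_def update_def intro!: exI[of _ "Suc S"] intro: order_less_le_trans)
      moreover have "\<mu> ?s < \<mu> s"
        using S \<open>Suc S \<le> _\<close> by (simp add: \<mu>_def update_def)
      ultimately show ?thesis by blast
    qed
    show "\<exists>k s'. exec (If ?b1 grow_cmd (If ?b2 grow_cmd ?adv)) s k s' \<and> k \<le> 5 \<and> scan_inv n m v s' \<and> \<mu> s' < \<mu> s"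
    proof (cases "bval ?b1 s")
      case True
      then have "2 ^ S \<le> fst (quotient_of (v (k div m) (k mod m)))"
        using S has_inputs_simps(3)[OF inp k] by simp
      from grow[OF this bit_size_le_input_size(1)[OF km]] exec_IfTrue[OF True]
      show ?thesis by fastforce
    next
      case False
      show ?thesis
      proof (cases "bval ?b2 s")
        case True
        then have "2 ^ S \<le> snd (quotient_of (v (k div m) (k mod m)))"
          using S has_inputs_simps(4)[OF inp k] by simp
        from grow[OF this bit_size_le_input_size(2)[OF km]] exec_IfFalse[OF False exec_IfTrue[OF True]]
        show ?thesis by fastforce
      next
        case F: False
        let ?s = "update s ''k'' 0 (s ''k'' 0 + 1)"
        have "exec (If ?b1 grow_cmd (If ?b2 grow_cmd ?adv)) s (1 + 1 + 1) ?s"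
          by (rule exec_IfFalse[OF False exec_IfFalse[OF F exec_Assign_eq]]) simp
        moreover have "scan_inv n m v ?s"
          unfolding scan_inv_def using inv S False F k
          by (auto simp: scan_inv_def has_inputs_def update_def less_Suc_eq intro!: exI[of _ S] exI[of _ "Suc k"])
        moreover have "int k < int n * int m" using k by (metis of_nat_less_iff of_nat_mult)
        then have "\<mu> ?s < \<mu> s" using S by (simp add: \<mu>_def update_def)
        ultimately show ?thesis by fastforce
      qed
    qed
  qed (rule assms)
  then obtain k s' where s': "exec scan_cmd s k s'" "k \<le> 7 * \<mu> s + 1" "scan_inv n m v s'"
    "\<not> bval (Less (Var ''k'') (Times (Var ''n'') (Var ''m''))) s'" by auto
  have \<mu>: "\<mu> s = n * m + input_size n m v" using assms by (simp add: \<mu>_def nat_mult_distrib)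
  from s'(3) obtain S k' where S: "S \<le> input_size n m v" "s' ''e'' 0 = int S"
      "s' ''k'' 0 = int k'" "k' \<le> n * m" "\<forall>l<k'. s' ''num'' (int l) < 2 ^ S \<and> s' ''den'' (int l) < 2 ^ S"
    by (auto simp: scan_inv_def)
  have inp: "has_inputs n m v s'" using s' by (simp add: scan_inv_def)
  have "k' = n * m" using S s'(4) has_inputs_simps[OF inp] by (simp flip: of_nat_mult)
  then have "fst (quotient_of (v i j)) < 2 ^ S \<and> snd (quotient_of (v i j)) < 2 ^ S" if "i < n" "j < m" for i j
    using S(5)[rule_format, of "i * m + j"] index_less[OF that] has_inputs_simps(5,6)[OF inp that] by simp
  moreover have "\<forall>x\<in>{''p'', ''o'', ''s'', ''i'', ''c'', ''x''}. s' x = (\<lambda>_. 0)"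
    using s'(3) by (simp add: scan_inv_def)
  ultimately show ?thesis using s'(1,2) inp S(1,2) unfolding \<mu> by blast
qed

section \<open>Correctness of the search for a best item\<close>

definition prices :: "state \<Rightarrow> nat \<Rightarrow> int" where
  "prices s j = s ''p'' (int j)"

definition owners :: "state \<Rightarrow> nat \<Rightarrow> nat" where
  "owners s j = nat (s ''o'' (int j))"

definition val :: "(nat \<Rightarrow> nat \<Rightarrow> rat) \<Rightarrow> nat \<Rightarrow> nat \<Rightarrow> real" where
  "val v i j = of_rat (v i j)"

lemma val_eq: "val v i j = fst (quotient_of (v i j)) / snd (quotient_of (v i j))"
proof -
  have "v i j = of_int (fst (quotient_of (v i j))) / of_int (snd (quotient_of (v i j)))"
    by (metis quotient_of_div prod.collapse)
  then show ?thesis unfolding val_def by (metis of_rat_divide of_rat_of_int_eq)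
qed

lemma den_pos: "0 < snd (quotient_of (q :: rat))"
  by (metis quotient_of_denom_pos prod.collapse)

lemma exec_search_cmd:
  assumes inp: "has_inputs n m v s" and i: "s ''i'' 0 = int i" "i < n" and m: "0 < m"
    and p: "\<And>j. j < m \<Longrightarrow> 0 \<le> prices s j"
  shows "\<exists>k s' b. exec search_cmd s k s' \<and> k \<le> 6 * m + 5 \<and>
    (\<forall>x. x \<noteq> ''b'' \<longrightarrow> x \<noteq> ''j'' \<longrightarrow> s' x = s x) \<and> s' ''b'' 0 = int b \<and> best_item m (val v) (prices s) i b"
proof -
  \<comment> \<open>Item \<open>b\<close> is best among those below \<open>j\<close>; at the start,
    \<open>b = 0\<close> is legal because \<open>m\<close> is positive.\<close>
  define I where "I s' \<longleftrightarrow> (\<forall>x. x \<noteq> ''b'' \<longrightarrow> x \<noteq> ''j'' \<longrightarrow> s' x = s x) \<and>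
    (\<exists>b j. s' ''b'' 0 = int b \<and> s' ''j'' 0 = int j \<and> b < m \<and> j \<le> m \<and>
      (\<forall>j'<j. val v i j' * (prices s b + 4) \<le> val v i b * (prices s j' + 4)))" for s'
  have I_I: "I s'" if "\<And>x. x \<noteq> ''b'' \<Longrightarrow> x \<noteq> ''j'' \<Longrightarrow> s' x = s x" "s' ''b'' 0 = int b" "s' ''j'' 0 = int j"
    "b < m" "j \<le> m" "\<And>j'. j' < j \<Longrightarrow> val v i j' * (prices s b + 4) \<le> val v i b * (prices s j' + 4)" for s' b j
    unfolding I_def using that by blast
  define entry where "entry = (\<lambda>x j. Cell x (Plus (Times (Var ''i'') (Var ''m'')) (Var j)))"
  define price where "price = (\<lambda>j. Plus (Cell ''p'' (Var j)) (Const 4))"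
  define test where "test = Less (Times (Times (entry ''num'' ''b'') (entry ''den'' ''j'')) (price ''j''))
                         (Times (Times (entry ''num'' ''j'') (entry ''den'' ''b'')) (price ''b''))"
  define body where "body = Seq (If test (Assign ''b'' (Const 0) (Var ''j'')) Skip)
            (Assign ''j'' (Const 0) (Plus (Var ''j'') (Const 1)))"
  have loop: "\<exists>k s''. exec (While (Less (Var ''j'') (Var ''m'')) body) s' k s'' \<and>
      k \<le> (4 + 2) * nat (int m - s' ''j'' 0) + 1 \<and> I s'' \<and> \<not> bval (Less (Var ''j'') (Var ''m'')) s''"
    if "I s'" for s'
  proof (rule exec_While[where I = I and \<mu> = "\<lambda>s. nat (int m - s ''j'' 0)", OF _ that])
    fix s' assume "I s'" and guard: "bval (Less (Var ''j'') (Var ''m'')) s'"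
    from \<open>I s'\<close> obtain b j where eq: "\<And>x. x \<noteq> ''b'' \<Longrightarrow> x \<noteq> ''j'' \<Longrightarrow> s' x = s x"
      and bj: "s' ''b'' 0 = int b" "s' ''j'' 0 = int j" "b < m" "j \<le> m"
      and le: "\<And>j'. j' < j \<Longrightarrow> val v i j' * (prices s b + 4) \<le> val v i b * (prices s j' + 4)"
      unfolding I_def by blast
    have j: "j < m" using guard eq[of "''m''"] has_inputs_simps(2)[OF inp] bj by simp
    have test: "bval test s' \<longleftrightarrow> val v i b * (prices s j + 4) < val v i j * (prices s b + 4)"
    proof -
      define nb db nj dj where q: "nb = fst (quotient_of (v i b))" "db = snd (quotient_of (v i b))"
        "nj = fst (quotient_of (v i j))" "dj = snd (quotient_of (v i j))"
      have "bval test s' \<longleftrightarrow> nb * dj * (prices s j + 4) < nj * db * (prices s b + 4)"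
        using has_inputs_simps(2,5,6)[OF inp] i bj j
        by (simp add: test_def entry_def price_def eq prices_def q)
      also have "\<dots> \<longleftrightarrow> real_of_int (nb * dj * (prices s j + 4)) < real_of_int (nj * db * (prices s b + 4))"
        by (rule of_int_less_iff[symmetric])
      also have "\<dots> \<longleftrightarrow> val v i b * (prices s j + 4) < val v i j * (prices s b + 4)"
        using den_pos[of "v i b"] den_pos[of "v i j"] unfolding val_eq q[symmetric]
        by (simp add: field_simps)
      finally show ?thesis .
    qed
    show "\<exists>k s''. exec body s' k s'' \<and> k \<le> 4 \<and> I s'' \<and> nat (int m - s'' ''j'' 0) < nat (int m - s' ''j'' 0)"
    proof (cases "bval test s'")
      case True
      let ?s = "update (update s' ''b'' 0 (int j)) ''j'' 0 (int j + 1)"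
      have "exec body s' (1 + 1 + 1 + 1) ?s" unfolding body_def
        by (rule exec_Seq[OF exec_IfTrue[OF True exec_Assign] exec_Assign_eq]) (simp add: update_def bj)
      moreover have "I ?s"
      proof -
        \<comment> \<open>Transitivity of the comparison of ratios, for which the positive prices
          are divided out.\<close>
        have "val v i j' * (prices s j + 4) \<le> val v i j * (prices s j' + 4)" if "j' < Suc j" for j'
        proof (cases "j' = j")
          case F: False
          then have j': "j' < j" "j' < m" using that j by auto
          have pos: "0 < real_of_int (prices s k + 4)" if "k < m" for k
            using p[OF that] by simp
          have "val v i j' / (prices s j' + 4) \<le> val v i b / (prices s b + 4)"
            using le[OF j'(1)] pos[OF j'(2)] pos[OF bj(3)] by (simp add: divide_simps mult.commute)
          also have "\<dots> < val v i j / (prices s j + 4)"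
            using True[unfolded test] pos[OF j] pos[OF bj(3)] by (simp add: divide_simps mult.commute)
          finally show ?thesis
            using pos[OF j'(2)] pos[OF j] by (simp add: divide_simps mult.commute)
        qed simp
        then show ?thesis using j by (intro I_I[of _ j "Suc j"]) (simp_all add: update_def eq)
      qed
      moreover have "nat (int m - ?s ''j'' 0) < nat (int m - s' ''j'' 0)" using bj j by (simp add: update_def)
      ultimately show ?thesis by (intro exI conjI) (assumption | simp)+
    next
      case False
      let ?s = "update s' ''j'' 0 (int j + 1)"
      have "exec body s' (0 + 1 + 1 + 1) ?s" unfolding body_def
        by (rule exec_Seq[OF exec_IfFalse[OF False exec_Skip] exec_Assign_eq]) (simp add: update_def bj)
      moreover have "I ?s"
      proof -
        have "val v i j' * (prices s b + 4) \<le> val v i b * (prices s j' + 4)" if "j' < Suc j" for j'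
          using le[of j'] False[unfolded test] that by (cases "j' = j") auto
        then show ?thesis using j by (intro I_I[of _ b "Suc j"]) (simp_all add: update_def eq bj)
      qed
      moreover have "nat (int m - ?s ''j'' 0) < nat (int m - s' ''j'' 0)" using bj j by (simp add: update_def)
      ultimately show ?thesis by (intro exI conjI) (assumption | simp)+
    qed
  qed
  let ?s = "update (update s ''b'' 0 0) ''j'' 0 0"
  have "I ?s" by (rule I_I[of _ 0 0]) (use m in \<open>simp_all add: update_def\<close>)
  from loop[OF this] obtain k s' where s': "exec (While (Less (Var ''j'') (Var ''m'')) body) ?s k s'"
    "k \<le> 6 * m + 1" "I s'" "\<not> bval (Less (Var ''j'') (Var ''m'')) s'"
    by (auto simp: update_def)
  have "exec search_cmd s (k + 2 + 2) s'"
    unfolding search_cmd_def Let_def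
    using s'(1) unfolding body_def test_def entry_def price_def
    by (intro exec_Assign_Seq) simp
  note search = this
  from s'(3) obtain b j where eq: "\<And>x. x \<noteq> ''b'' \<Longrightarrow> x \<noteq> ''j'' \<Longrightarrow> s' x = s x"
      and bj: "s' ''b'' 0 = int b" "s' ''j'' 0 = int j" "b < m" "j \<le> m"
      and le: "\<And>j'. j' < j \<Longrightarrow> val v i j' * (prices s b + 4) \<le> val v i b * (prices s j' + 4)"
      unfolding I_def by blast
  have "j = m" using s'(4) bj eq[of "''m''"] has_inputs_simps(2)[OF inp] by simp
  then have "best_item m (val v) (prices s) i b" unfolding best_item_def using bj(3) le by blast
  moreover have "k + 2 + 2 \<le> 6 * m + 5" using s'(2) by simp
  ultimately show ?thesis using search eq bj(1) by blast
qed

section \<open>Counting bids\<close>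

text \<open>\<open>f j\<close> is the number of bids on item \<open>j\<close>. The program keeps
  only the sum \<open>c\<close>, so \<open>f\<close> is existentially quantified.\<close>

definition bid_count :: "nat \<Rightarrow> nat \<Rightarrow> (nat \<Rightarrow> int) \<Rightarrow> nat \<Rightarrow> bool" where
  "bid_count m N p c \<longleftrightarrow>
     (\<exists>f. c = sum f {..<m} \<and> (\<forall>j<m. (9 / 8) ^ f j \<le> real_of_int (p j + 4) \<and> f j \<le> N))"

lemma bid_count_le: "bid_count m N p c \<Longrightarrow> c \<le> m * N"
  using sum_bounded_above[of "{..<m}" _ N] by (fastforce simp: bid_count_def)

text \<open>A price below \<open>(9 / 8) ^ N\<close> means fewer than \<open>N\<close> bids so far,
  so one more is within the limit.\<close>

lemma bid_count_bid:
  assumes "bid_count m N p c" "b < m" "0 \<le> p b" "real_of_int (p b + 4) < (9 / 8) ^ N"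
  shows "bid_count m N (p(b := raise (p b))) (Suc c)"
proof -
  obtain f where f: "c = sum f {..<m}" "\<And>j. j < m \<Longrightarrow> (9 / 8) ^ f j \<le> real_of_int (p j + 4) \<and> f j \<le> N"
    using assms(1) by (auto simp: bid_count_def)
  have "(9 / 8 :: real) ^ f b < (9 / 8) ^ N" using f(2)[OF assms(2)] assms(4) by linarith
  then have lt: "f b < N" by (simp add: power_strict_increasing_iff)
  have "sum (f(b := Suc (f b))) {..<m} = Suc (sum f {..<m})"
    using assms(2) sum.remove[of "{..<m}" b f] sum.remove[of "{..<m}" b "f(b := Suc (f b))"]
      sum.cong[of "{..<m} - {b}" "{..<m} - {b}" "f(b := Suc (f b))" f] by simp
  moreover have "(9 / 8) ^ Suc (f b) \<le> real_of_int (raise (p b) + 4)"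
  proof -
    have "(9 / 8) ^ Suc (f b) \<le> 9 / 8 * real_of_int (p b + 4)" using f(2)[OF assms(2)] by simp
    also have "\<dots> \<le> real_of_int (raise (p b) + 4)"
    proof -
      have "real_of_int (9 * (p b + 4)) \<le> real_of_int (8 * (raise (p b) + 4))"
        using raise_bounds(4)[OF assms(3)] by (simp only: of_int_le_iff)
      then show ?thesis by simp
    qed
    finally show ?thesis .
  qed
  ultimately show ?thesis
    unfolding bid_count_def using f lt by (intro exI[of _ "f(b := Suc (f b))"]) (auto simp del: power_Suc)
qed

text \<open>This mirrors the updates of \<open>s\<close> in \<open>bid_cmd\<close>; both corrections
  apply if the bidder already owns \<open>b\<close>.\<close>

lemma sum_items_of_bid:
  fixes p :: "nat \<Rightarrow> int"
  assumes "b < m"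
  shows "sum (p(b := r)) (items_of m (ow(b := i)) h) =
    sum p (items_of m ow h) - (if h = ow b then p b else 0) + (if h = i then r else 0)"
proof -
  have eq: "sum p (items_of m ow h) = (\<Sum>j<m. if ow j = h then p j else 0)" for p :: "nat \<Rightarrow> int" and ow
    unfolding items_of_def by (simp add: sum.inter_filter[symmetric])
  have "(\<Sum>j\<in>{..<m} - {b}. if (ow(b := i)) j = h then (p(b := r)) j else 0) =
      (\<Sum>j\<in>{..<m} - {b}. if ow j = h then p j else 0)"
    by (intro sum.cong) auto
  then show ?thesis
    unfolding eq using assms sum.remove[of "{..<m}" b "\<lambda>j. if (ow(b := i)) j = h then (p(b := r)) j else 0"]
      sum.remove[of "{..<m}" b "\<lambda>j. if ow j = h then p j else 0"]
    by simp
qed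

text \<open>This form of Hall's condition follows from a positive optimum and is what bounds the
  prices.\<close>

definition has_matching :: "nat \<Rightarrow> nat \<Rightarrow> (nat \<Rightarrow> nat \<Rightarrow> real) \<Rightarrow> bool" where
  "has_matching n m u \<longleftrightarrow> (\<exists>f. inj_on f {..<n} \<and> (\<forall>i<n. f i < m \<and> 0 < u i (f i)))"

text \<open>The price bound of the Hall argument is below \<open>2\<close> to the power of \<open>6 + m (2 S + 2)\<close>, and six bids
  at least double a price, as \<open>(9/8)\<^sup>6 > 2\<close>.\<close>

definition max_bids :: "nat \<Rightarrow> nat \<Rightarrow> nat" where
  "max_bids m S = 6 * (6 + m * (2 * S + 2))"

text \<open>From \<open>m + 1 \<le> 2 ^ m\<close> the first factor is below
  \<open>2 ^ (6 + m)\<close>; the second is \<open>2 ^ ((2 * S + 1) * m)\<close>.\<close>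

lemma price_bound_less_power:
  "(40 * real m + 4) * (2 * 2 ^ (2 * S)) ^ m < (9 / 8) ^ max_bids m S"
proof -
  have "40 * real m + 4 < 64 * 2 ^ m"
  proof -
    have "real m + 1 \<le> 2 ^ m" using less_exp[of m] by (metis Suc_leI of_nat_Suc of_nat_le_iff of_nat_numeral of_nat_power add.commute)
    then show ?thesis by linarith
  qed
  then have "(40 * real m + 4) * (2 * 2 ^ (2 * S)) ^ m < (64 * 2 ^ m) * (2 * 2 ^ (2 * S)) ^ m"
    by (intro mult_strict_right_mono) simp_all
  also have "\<dots> = 2 ^ (6 + m * (2 * S + 2))"
  proof -
    have "(64 * 2 ^ m) * (2 * 2 ^ (2 * S)) ^ m = (2::real) ^ 6 * 2 ^ m * (2 ^ (Suc (2 * S))) ^ m" by simp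
    also have "\<dots> = 2 ^ (6 + m + Suc (2 * S) * m)" by (simp only: power_add power_mult)
    finally show ?thesis by (simp add: algebra_simps)
  qed
  also have "\<dots> \<le> ((9 / 8) ^ 6) ^ (6 + m * (2 * S + 2))"
    by (intro power_mono) (simp_all add: power_numeral_reduce)
  also have "\<dots> = (9 / 8) ^ max_bids m S" by (simp only: max_bids_def power_mult)
  finally show ?thesis .
qed

text \<open>Values are at most \<open>2 ^ S\<close> as denominators are at least 1, and positive
  values are at least \<open>1 / 2 ^ S\<close> as numerators are then at least 1.\<close>

lemma val_ratio_le:
  assumes "fst (quotient_of (v i j)) < 2 ^ S" "snd (quotient_of (v i j')) < 2 ^ S" "0 < val v i j'"
  shows "val v i j \<le> 2 ^ (2 * S) * val v i j'"
proof -
  define a b c d where q: "a = fst (quotient_of (v i j))" "b = snd (quotient_of (v i j))"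
    "c = fst (quotient_of (v i j'))" "d = snd (quotient_of (v i j'))"
  have pos: "1 \<le> b" "1 \<le> d" using den_pos[of "v i j"] den_pos[of "v i j'"] by (auto simp: q)
  have "0 < c" using assms(3) pos unfolding val_eq q[symmetric] by (simp add: zero_less_divide_iff)
  have "real_of_int a \<le> 2 ^ S" using assms(1) unfolding q[symmetric]
    by (metis less_imp_le of_int_le_iff of_int_numeral of_int_power)
  moreover have d: "real_of_int d \<le> 2 ^ S" using assms(2) unfolding q[symmetric]
    by (metis less_imp_le of_int_le_iff of_int_numeral of_int_power)
  ultimately have "a / b \<le> 2 ^ S"
  proof -
    have "2 ^ S * 1 \<le> 2 ^ S * real_of_int b" using pos by (intro mult_left_mono) auto
    then have "real_of_int a \<le> 2 ^ S * real_of_int b" using \<open>real_of_int a \<le> _\<close> by linarith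
    then show ?thesis using pos by (simp add: divide_simps)
  qed
  also have "\<dots> \<le> 2 ^ S * (2 ^ S * (c / d))"
  proof -
    have "real_of_int d * 1 \<le> 2 ^ S * real_of_int c" using d \<open>0 < c\<close> pos by (intro mult_mono) auto
    then have "1 \<le> 2 ^ S * (c / d)" using pos by (simp add: divide_simps)
    then have "2 ^ S * 1 \<le> 2 ^ S * (2 ^ S * (c / d))" by (intro mult_left_mono) auto
    then show ?thesis by simp
  qed
  also have "\<dots> = 2 ^ (2 * S) * (c / d)" by (simp add: mult_2 power_add)
  finally show ?thesis unfolding val_eq q[symmetric] .
qed

section \<open>Auction loop and output\<close>

locale auction =
  fixes n m :: nat and v :: "nat \<Rightarrow> nat \<Rightarrow> rat" and S :: nat
  assumes inst: "nsw_instance n m v"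
    and small: "\<And>i j. i < n \<Longrightarrow> j < m \<Longrightarrow> fst (quotient_of (v i j)) < 2 ^ S \<and> snd (quotient_of (v i j)) < 2 ^ S"
begin

lemma val_nonneg: "i < n \<Longrightarrow> j < m \<Longrightarrow> 0 \<le> val v i j"
  using inst by (simp add: nsw_instance_def val_def)

text \<open>The bids on single items are bounded only if there is a matching; without one, just the
  cap limits \<open>c\<close>.\<close>

definition inv :: "nat \<Rightarrow> nat \<Rightarrow> state \<Rightarrow> bool" where
  "inv i c s \<longleftrightarrow> has_inputs n m v s \<and> s ''x'' = (\<lambda>_. 0) \<and> s ''e'' 0 = int S \<and>
     auction_inv n m (val v) (40 * int m) (prices s) (owners s) \<and> (\<forall>j<m. 0 \<le> s ''o'' (int j)) \<and>
     (\<forall>h<n. s ''s'' (int h) = sum (prices s) (items_of m (owners s) h)) \<and>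
     s ''i'' 0 = int i \<and> i \<le> n \<and> s ''c'' 0 = int c \<and> c \<le> m * max_bids m S + 1 \<and>
     (\<forall>h<i. 40 * int m \<le> sum (prices s) (items_of m (owners s) h)) \<and>
     (has_matching n m (val v) \<longrightarrow> bid_count m (max_bids m S) (prices s) c)"

lemma exec_bid:
  assumes inv: "inv i c s" and i: "i < n" and c: "c \<le> m * max_bids m S"
    and poor: "sum (prices s) (items_of m (owners s) i) < 40 * int m"
  shows "\<exists>k s'. exec (Seq search_cmd bid_cmd) s k s' \<and> k \<le> 6 * m + 17 \<and> inv 0 (Suc c) s'"
proof -
  let ?p = "prices s" and ?ow = "owners s"
  have inp: "has_inputs n m v s" and "s ''i'' 0 = int i" and ai: "auction_inv n m (val v) (40 * int m) ?p ?ow"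
    using inv by (auto simp: inv_def)
  have p: "0 \<le> ?p j" "?ow j < n" if "j < m" for j using ai that by (auto simp: auction_inv_def)
  have "0 < m"
  proof (rule ccontr)
    assume "\<not> 0 < m"
    then have "items_of m ?ow i = {}" by (simp add: items_of_def)
    then show False using poor \<open>\<not> 0 < m\<close> by simp
  qed
  then have "\<exists>k s' b. exec search_cmd s k s' \<and> k \<le> 6 * m + 5 \<and>
      (\<forall>x. x \<noteq> ''b'' \<longrightarrow> x \<noteq> ''j'' \<longrightarrow> s' x = s x) \<and> s' ''b'' 0 = int b \<and> best_item m (val v) ?p i b"
    by (rule exec_search_cmd[OF inp \<open>s ''i'' 0 = int i\<close> i]) (rule p(1))
  then obtain k s1 b where search: "exec search_cmd s k s1" "k \<le> 6 * m + 5"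
    and eq_all: "\<forall>x. x \<noteq> ''b'' \<longrightarrow> x \<noteq> ''j'' \<longrightarrow> s1 x = s x"
    and b: "s1 ''b'' 0 = int b" and best: "best_item m (val v) ?p i b"
    by (elim exE conjE)
  note eq = eq_all[rule_format]
  have bm: "b < m" using best by (simp add: best_item_def)
  let ?ob = "s ''o'' (int b)"
  have ob: "?ob = int (?ow b)" using inv bm by (simp add: inv_def owners_def)
  let ?t1 = "update s1 ''s'' ?ob (s ''s'' ?ob - ?p b)"
  let ?t2 = "update ?t1 ''p'' (int b) (raise (?p b))"
  let ?t3 = "update ?t2 ''o'' (int b) (int i)"
  let ?t4 = "update ?t3 ''s'' (int i) (?t1 ''s'' (int i) + raise (?p b))"
  let ?t5 = "update ?t4 ''c'' 0 (int c + 1)"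
  let ?t = "update ?t5 ''i'' 0 0"
  have "exec bid_cmd s1 (1 + 2 + 2 + 2 + 2 + 2) ?t"
    unfolding bid_cmd_def Let_def
    by (intro exec_Assign_Seq exec_Assign_eq)
      (use inv in \<open>simp add: update_def eq b prices_def raise_def inv_def\<close>)
  from exec_Seq[OF search(1) this]
  have ex: "exec (Seq search_cmd bid_cmd) s (k + (1 + 2 + 2 + 2 + 2 + 2) + 1) ?t" .
  have pr: "prices ?t = ?p(b := raise (?p b))" by (rule ext) (simp add: prices_def update_def eq)
  have ow: "owners ?t = ?ow(b := i)" by (rule ext) (simp add: owners_def update_def eq)
  have "inv 0 (Suc c) ?t"
    unfolding inv_def pr ow
  proof (intro conjI impI)
    show "has_inputs n m v ?t" using inp by (simp add: has_inputs_def update_def eq)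
    show "?t ''x'' = (\<lambda>_. 0)" "?t ''e'' 0 = int S" using inv by (simp_all add: inv_def update_def eq)
    show "auction_inv n m (val v) (40 * int m) (?p(b := raise (?p b))) (?ow(b := i))"
      using poor by (intro auction_inv_bid[OF ai i _ best val_nonneg]) auto
    show "\<forall>j<m. 0 \<le> ?t ''o'' (int j)" using inv by (simp add: inv_def update_def eq)
    show "\<forall>h<n. ?t ''s'' (int h) = sum (?p(b := raise (?p b))) (items_of m (?ow(b := i)) h)"
    proof (intro allI impI)
      fix h assume "h < n"
      then have "s ''s'' (int h) = sum ?p (items_of m ?ow h)" using inv by (simp add: inv_def)
      moreover have "s ''s'' (int (?ow b)) = sum ?p (items_of m ?ow (?ow b))"
        using inv p(2)[OF bm] by (simp add: inv_def)
      ultimately show "?t ''s'' (int h) = sum (?p(b := raise (?p b))) (items_of m (?ow(b := i)) h)"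
        unfolding sum_items_of_bid[OF bm] ob by (auto simp: update_def eq)
    qed
    show "?t ''i'' 0 = int 0" "?t ''c'' 0 = int (Suc c)" by (simp_all add: update_def)
    show "Suc c \<le> m * max_bids m S + 1" using c by simp
    assume hm: "has_matching n m (val v)"
    then obtain f where f: "inj_on f {..<n}" "\<And>i. i < n \<Longrightarrow> f i < m \<and> 0 < val v i (f i)"
      by (auto simp: has_matching_def)
    \<comment> \<open>The Hall argument with \<open>W = 2 ^ (2 * S)\<close>, applied before the bid
      while \<open>i\<close> is still poor.\<close>
    have "real_of_int (?p b) + 4 \<le> (real_of_int (40 * int m) + 4) * (2 * 2 ^ (2 * S)) ^ m"
    proof (rule best_item_price_le[OF ai i poor best _ f(1)])
      show "val v h j \<le> 2 ^ (2 * S) * val v h j'" if "h < n" "j < m" "j' < m" "0 < val v h j'" for h j j'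
        using small that by (intro val_ratio_le) auto
    qed (use val_nonneg f(2) in auto)
    also have "\<dots> < (9 / 8) ^ max_bids m S" using price_bound_less_power[of m S] by simp
    finally have "real_of_int (?p b + 4) < (9 / 8) ^ max_bids m S" by simp
    moreover have "bid_count m (max_bids m S) ?p c" using inv hm by (simp add: inv_def)
    ultimately show "bid_count m (max_bids m S) (?p(b := raise (?p b))) (Suc c)"
      by (intro bid_count_bid bm p(1))
  qed simp_all
  moreover have "k + (1 + 2 + 2 + 2 + 2 + 2) + 1 \<le> 6 * m + 17" using search(2) by simp
  ultimately show ?thesis using ex by blast
qed

lemma exec_auction_cmd:
  assumes "inv 0 0 s"
  shows "\<exists>k s' i. exec auction_cmd s k s' \<and>
    k \<le> (6 * m + 20) * ((m * max_bids m S + 1) * (n + 1) + n) + 1 \<and> inv i (nat (s' ''c'' 0)) s' \<and>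
    (has_matching n m (val v) \<longrightarrow> i = n)"
proof -
  define K where "K = m * max_bids m S + 1"
  define I where "I s \<longleftrightarrow> (\<exists>i c. inv i c s)" for s
  \<comment> \<open>A lexicographic measure: a bid may raise the second part by up to
    \<open>n\<close>, which the weight \<open>n + 1\<close> of the first part outweighs.\<close>
  define \<mu> where "\<mu> s = nat (int K - s ''c'' 0) * (n + 1) + nat (int n - s ''i'' 0)" for s :: state
  define g where "g = Conj (Less (Var ''i'') (Var ''n''))
       (Less (Var ''c'') (Plus (Times (Times (Const 6) (Var ''m''))
         (Plus (Const 6) (Times (Var ''m'') (Plus (Plus (Var ''e'') (Var ''e'')) (Const 2))))) (Const 1)))"
  define test where "test = Less (Cell ''s'' (Var ''i'')) (Times (Const 40) (Var ''m''))"
  define adv where "adv = Assign ''i'' (Const 0) (Plus (Var ''i'') (Const 1))"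
  have cmd: "auction_cmd = While g (If test (Seq search_cmd bid_cmd) adv)"
    by (simp add: auction_cmd_def g_def test_def adv_def)
  have g: "bval g s \<longleftrightarrow> i < n \<and> c < K" if "inv i c s" for i c s
  proof -
    have *: "s ''n'' 0 = int n" "s ''m'' 0 = int m" "s ''e'' 0 = int S" "s ''i'' 0 = int i" "s ''c'' 0 = int c"
      using that has_inputs_simps(1,2)[of n m v s] by (auto simp: inv_def)
    have "6 * int m * (6 + int m * (int S + int S + 2)) + 1 = int K"
      by (simp add: K_def max_bids_def algebra_simps)
    then show ?thesis by (simp add: g_def *)
  qed
  have "\<exists>k s'. exec auction_cmd s k s' \<and> k \<le> (6 * m + 18 + 2) * \<mu> s + 1 \<and> I s' \<and> \<not> bval g s'"
    unfolding cmd
  proof (rule exec_While)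
    fix s assume "I s" "bval g s"
    then obtain i c where inv: "inv i c s" and ic: "i < n" "c < K" using g by (auto simp: I_def)
    have s: "s ''i'' 0 = int i" "s ''c'' 0 = int c" "s ''m'' 0 = int m"
      "s ''s'' (int i) = sum (prices s) (items_of m (owners s) i)"
      using inv ic has_inputs_simps(2)[of n m v s] by (auto simp: inv_def)
    have \<mu>s: "\<mu> s = (K - c) * (n + 1) + (n - i)" unfolding \<mu>_def s by (simp only: nat_minus_as_int)
    show "\<exists>k s'. exec (If test (Seq search_cmd bid_cmd) adv) s k s' \<and> k \<le> 6 * m + 18 \<and> I s' \<and> \<mu> s' < \<mu> s"
    proof (cases "bval test s")
      case True
      then have "sum (prices s) (items_of m (owners s) i) < 40 * int m" by (simp add: test_def s)
      with exec_bid[OF inv ic(1)] ic(2) obtain k s' where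
        s': "exec (Seq search_cmd bid_cmd) s k s'" "k \<le> 6 * m + 17" "inv 0 (Suc c) s'"
        by (auto simp: K_def)
      have "\<mu> s' = (K - Suc c) * (n + 1) + n" using s'(3) by (simp add: \<mu>_def inv_def nat_minus_as_int)
      moreover have "K - c = Suc (K - Suc c)" using ic by simp
      ultimately have "\<mu> s' < \<mu> s" unfolding \<mu>s by simp
      moreover have "exec (If test (Seq search_cmd bid_cmd) adv) s (k + 1) s'"
        by (rule exec_IfTrue[OF True s'(1)])
      moreover have "k + 1 \<le> 6 * m + 18" "I s'" using s' by (auto simp: I_def)
      ultimately show ?thesis by blast
    next
      case False
      let ?s = "update s ''i'' 0 (int i + 1)"
      have "exec (If test (Seq search_cmd bid_cmd) adv) s (1 + 1) ?s"
        unfolding adv_def by (rule exec_IfFalse[OF False exec_Assign_eq]) (simp add: s)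
      moreover have "inv (Suc i) c ?s"
      proof -
        have "40 * int m \<le> sum (prices s) (items_of m (owners s) h)" if "h < Suc i" for h
          using inv False that by (cases "h = i") (auto simp: inv_def test_def s)
        moreover have "prices ?s = prices s" "owners ?s = owners s"
          by (auto simp: prices_def owners_def update_def)
        ultimately show ?thesis using inv ic by (simp add: inv_def has_inputs_def update_def)
      qed
      then have "I ?s" by (auto simp: I_def)
      moreover have "\<mu> ?s = (K - c) * (n + 1) + (n - Suc i)"
        by (simp add: \<mu>_def update_def s nat_minus_as_int add.commute)
      then have "\<mu> ?s < \<mu> s" unfolding \<mu>s using ic by simp
      moreover have "1 + 1 \<le> 6 * m + 18" by simp
      ultimately show ?thesis by blast
    qed
  qed (use assms in \<open>auto simp: I_def\<close>)
  then obtain k s' i c where s': "exec auction_cmd s k s'" "k \<le> (6 * m + 18 + 2) * \<mu> s + 1"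
    "inv i c s'" "\<not> (i < n \<and> c < K)"
    using g unfolding I_def by blast
  have \<mu>: "\<mu> s = K * (n + 1) + n" using assms by (simp add: \<mu>_def inv_def)
  have "nat (s' ''c'' 0) = c" using s' by (simp add: inv_def)
  \<comment> \<open>With a matching the cap is never reached, so the loop ends because no agent is
    poor.\<close>
  moreover have "i = n" if "has_matching n m (val v)"
  proof -
    have "c \<le> m * max_bids m S" using s'(3) that by (auto simp: inv_def intro: bid_count_le)
    moreover have "i \<le> n" using s'(3) by (simp add: inv_def)
    ultimately show ?thesis using s'(4) by (simp add: K_def)
  qed
  moreover have "k \<le> (6 * m + 20) * ((m * max_bids m S + 1) * (n + 1) + n) + 1"
  proof -
    have "6 * m + 18 + 2 = 6 * m + 20" by simp
    then show ?thesis using s'(2) unfolding \<mu> K_def by (simp only:)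
  qed
  ultimately show ?thesis using s'(1,3) by metis
qed

lemma exec_output_cmd:
  assumes inp: "has_inputs n m v s" and x: "s ''x'' = (\<lambda>_. 0)" and o: "\<And>j. j < m \<Longrightarrow> 0 \<le> s ''o'' (int j)"
  shows "\<exists>k s'. exec output_cmd s k s' \<and> k \<le> 5 * m + 3 \<and>
    (\<forall>i<n. \<forall>j<m. output_of m s' i j = (if owners s j = i then 1 else 0))"
proof -
  define I where "I s' \<longleftrightarrow> s' ''m'' = s ''m'' \<and> s' ''o'' = s ''o'' \<and>
    (\<exists>j'\<le>m. s' ''j'' 0 = int j' \<and>
       (\<forall>i<n. \<forall>j<m. output_of m s' i j = (if j < j' \<and> owners s j = i then 1 else 0)))" for s'
  have m: "s ''m'' 0 = int m" using has_inputs_simps[OF inp] by simp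
  let ?body = "Seq (Assign ''x'' (Plus (Times (Cell ''o'' (Var ''j'')) (Var ''m'')) (Var ''j'')) (Const 1))
       (Assign ''j'' (Const 0) (Plus (Var ''j'') (Const 1)))"
  let ?s = "update s ''j'' 0 0"
  have "I ?s" by (auto simp: I_def update_def x output_of_def intro!: exI[of _ 0])
  have "\<exists>k s'. exec (While (Less (Var ''j'') (Var ''m'')) ?body) ?s k s' \<and>
     k \<le> (3 + 2) * nat (int m - ?s ''j'' 0) + 1 \<and> I s' \<and> \<not> bval (Less (Var ''j'') (Var ''m'')) s'"
  proof (rule exec_While[where I = I and \<mu> = "\<lambda>s. nat (int m - s ''j'' 0)", OF _ \<open>I ?s\<close>])
    fix s' assume "I s'" and guard: "bval (Less (Var ''j'') (Var ''m'')) s'"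
    then obtain j' where eq: "s' ''m'' = s ''m''" "s' ''o'' = s ''o''" and j': "s' ''j'' 0 = int j'" "j' \<le> m"
      and out: "\<And>i j. i < n \<Longrightarrow> j < m \<Longrightarrow> output_of m s' i j = (if j < j' \<and> owners s j = i then 1 else 0)"
      by (auto simp: I_def)
    have lt: "j' < m" using guard by (simp add: eq m j')
    have oj: "s ''o'' (int j') = int (owners s j')" using o[OF lt] by (simp add: owners_def)
    let ?t = "update (update s' ''x'' (int (owners s j' * m + j')) 1) ''j'' 0 (int j' + 1)"
    have "exec ?body s' (1 + 2) ?t"
      by (rule exec_Assign_Seq[OF exec_Assign_eq]) (simp add: update_def eq m j' oj)
    moreover have "I ?t"
    proof -
      \<comment> \<open>Row-major positions are unique, so writing one cell changes just one entry
        of the matrix.\<close>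
      have inj: "i * m + j = owners s j' * m + j' \<longleftrightarrow> i = owners s j' \<and> j = j'" if "j < m" for i j
      proof
        assume *: "i * m + j = owners s j' * m + j'"
        have "(i * m + j) div m = i" "(i * m + j) mod m = j" using that by auto
        moreover have "(owners s j' * m + j') div m = owners s j'" "(owners s j' * m + j') mod m = j'"
          using lt by auto
        ultimately show "i = owners s j' \<and> j = j'" unfolding * by simp
      qed simp
      have "output_of m ?t i j = (if j < Suc j' \<and> owners s j = i then 1 else 0)" if "i < n" "j < m" for i j
      proof -
        have "output_of m ?t i j = (if i * m + j = owners s j' * m + j' then 1 else output_of m s' i j)"
          using of_nat_eq_iff[where 'a = int, of "i * m + j" "owners s j' * m + j'"]
          by (simp add: output_of_def update_def del: of_nat_eq_iff)
        then show ?thesis unfolding inj[OF that(2)] out[OF that] by (auto simp: less_Suc_eq)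
      qed
      moreover have "?t ''m'' = s ''m''" "?t ''o'' = s ''o''" "?t ''j'' 0 = int (Suc j')"
        by (simp_all add: update_def eq)
      ultimately show ?thesis unfolding I_def using lt by (intro conjI exI[of _ "Suc j'"]) simp_all
    qed
    moreover have "nat (int m - ?t ''j'' 0) < nat (int m - s' ''j'' 0)" using j' lt by (simp add: update_def)
    moreover have "1 + 2 \<le> (3::nat)" by simp
    ultimately show "\<exists>k s''. exec ?body s' k s'' \<and> k \<le> 3 \<and> I s'' \<and>
        nat (int m - s'' ''j'' 0) < nat (int m - s' ''j'' 0)" by blast
  qed
  then obtain k s' where s': "exec (While (Less (Var ''j'') (Var ''m'')) ?body) ?s k s'"
    "k \<le> 5 * m + 1" "I s'" "\<not> bval (Less (Var ''j'') (Var ''m'')) s'" by (auto simp: update_def)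
  have "exec output_cmd s (k + 2) s'"
    unfolding output_cmd_def by (rule exec_Assign_Seq) (use s'(1) in simp)
  moreover have "\<forall>i<n. \<forall>j<m. output_of m s' i j = (if owners s j = i then 1 else 0)"
    using s'(3,4) m by (auto simp: I_def)
  moreover have "k + 2 \<le> 5 * m + 3" using s'(2) by simp
  ultimately show ?thesis by blast
qed

end

section \<open>Approximation\<close>

lemma agent_value_eq:
  assumes "\<And>j. j < m \<Longrightarrow> x i j = (if A j = i then 1 else 0)"
  shows "agent_value m v x i = sum (val v i) (items_of m A i)"
proof -
  have "agent_value m v x i = (\<Sum>j<m. if A j = i then val v i j else 0)"
    unfolding agent_value_def val_def by (intro sum.cong) (simp_all add: assms)
  also have "\<dots> = sum (val v i) (items_of m A i)"
    unfolding items_of_def by (simp add: sum.inter_filter[symmetric])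
  finally show ?thesis .
qed

lemma is_allocation_owners:
  assumes "\<And>i j. i < n \<Longrightarrow> j < m \<Longrightarrow> x i j = (if A j = i then 1 else 0)" "\<And>j. j < m \<Longrightarrow> A j < n"
  shows "is_allocation n m x"
  unfolding is_allocation_def using assms by (auto intro!: ex1I[where a = "A _"] split: if_splits)

lemma is_allocation_obtain_owners:
  assumes "is_allocation n m x"
  obtains A where "\<And>i j. i < n \<Longrightarrow> j < m \<Longrightarrow> x i j = (if A j = i then 1 else 0)" "\<And>j. j < m \<Longrightarrow> A j < n"
proof -
  have "\<forall>j<m. \<exists>a. a < n \<and> (\<forall>i<n. x i j = 1 \<longrightarrow> i = a) \<and> x a j = 1"
    using assms unfolding is_allocation_def by metis
  then obtain A where A: "\<And>j. j < m \<Longrightarrow> A j < n \<and> (\<forall>i<n. x i j = 1 \<longrightarrow> i = A j) \<and> x (A j) j = 1"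
    by metis
  show thesis
  proof (rule that)
    fix i j assume ij: "i < n" "j < m"
    then have "x i j \<in> {0, 1}" using assms by (simp add: is_allocation_def)
    then show "x i j = (if A j = i then 1 else 0)" using A[OF ij(2)] ij by auto
  qed (use A in blast)
qed

text \<open>Each agent has an item of positive value in her bundle, and these items differ as the
  bundles are disjoint.\<close>

lemma has_matching_if_opt_pos:
  assumes inst: "nsw_instance n m v" and pos: "0 < (\<Prod>i<n. sum (val v i) (items_of m A i))"
  shows "has_matching n m (val v)"
proof -
  have nonneg: "0 \<le> val v i j" if "i < n" "j < m" for i j
    using inst that by (simp add: nsw_instance_def val_def)
  have "\<exists>j. j < m \<and> A j = i \<and> 0 < val v i j" if "i < n" for i
  proof -
    have "sum (val v i) (items_of m A i) \<noteq> 0"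
    proof
      assume "sum (val v i) (items_of m A i) = 0"
      with that have "(\<Prod>i<n. sum (val v i) (items_of m A i)) = 0" by (intro prod_zero) auto
      with pos show False by (simp only: less_irrefl)
    qed
    then obtain j where "j \<in> items_of m A i" "val v i j \<noteq> 0" by (meson sum.neutral)
    then show ?thesis using nonneg[OF that, of j] by (auto simp: items_of_def)
  qed
  then obtain f where f: "\<And>i. i < n \<Longrightarrow> f i < m \<and> A (f i) = i \<and> 0 < val v i (f i)" by metis
  have "inj_on f {..<n}" by (rule inj_onI) (metis f lessThan_iff)
  then show ?thesis unfolding has_matching_def using f by blast
qed

text \<open>The first four terms of the series already sum up to \<open>8/3\<close>.\<close>

lemma exp_one_ge: "21 / 8 \<le> exp (1::real)"
proof -
  have "(\<Sum>k<4. 1 / fact k) \<le> exp (1::real)"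
  proof -
    have "(\<Sum>k<4. (1::real) ^ k /\<^sub>R fact k) \<le> (\<Sum>k. 1 ^ k /\<^sub>R fact k)"
      by (intro sum_le_suminf summable_exp_generic) auto
    then show ?thesis by (simp add: exp_def divide_inverse)
  qed
  moreover have "(\<Sum>k<4. 1 / fact k) = (8 / 3 :: real)" by (simp add: eval_nat_numeral)
  ultimately show ?thesis by simp
qed

lemma (in auction) nsw_ge:
  assumes inv: "inv i c s" and i: "has_matching n m (val v) \<longrightarrow> i = n"
    and x: "\<And>i j. i < n \<Longrightarrow> j < m \<Longrightarrow> x i j = (if owners s j = i then 1 else 0)"
  shows "1 / exp 1 * opt_nsw n m v \<le> nsw n m v x"
proof -
  have n: "1 \<le> n" using inst by (simp add: nsw_instance_def)
  obtain y where y: "is_allocation n m y" "nsw n m v y = opt_nsw n m v"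
    using opt_nsw_is_maximum(1)[OF inst] by blast
  obtain A where A: "\<And>i j. i < n \<Longrightarrow> j < m \<Longrightarrow> y i j = (if A j = i then 1 else 0)" "\<And>j. j < m \<Longrightarrow> A j < n"
    using is_allocation_obtain_owners[OF y(1)] by blast
  have sum_nonneg: "0 \<le> sum (val v i) (items_of m B i)" if "i < n" for B i
    using val_nonneg[OF that] by (intro sum_nonneg) (auto simp: items_of_def)
  let ?opt = "\<Prod>i<n. sum (val v i) (items_of m A i)"
    and ?out = "\<Prod>i<n. sum (val v i) (items_of m (owners s) i)"
  have opt: "opt_nsw n m v = root n ?opt"
    unfolding y(2)[symmetric] nsw_def using A by (simp add: agent_value_eq[where A = A])
  have out: "nsw n m v x = root n ?out"
    unfolding nsw_def using x by (simp add: agent_value_eq[where A = "owners s"])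
  have nonneg: "0 \<le> ?opt" "0 \<le> ?out" using sum_nonneg by (auto intro!: prod_nonneg)
  have "root n ?opt \<le> 21 / 8 * root n ?out"
  proof (cases "?opt = 0")
    \<comment> \<open>The claim is trivial here, which covers an auction stopped by the cap.\<close>
    case True
    have "0 \<le> root n ?out" using nonneg(2) by (rule real_root_ge_zero)
    then show ?thesis unfolding True by simp
  next
    case False
    then have "0 < ?opt" using nonneg(1) by (simp only: less_le) simp
    then have hm: "has_matching n m (val v)"
      by (rule has_matching_if_opt_pos[OF inst])
    then have "i = n" using i by simp
    obtain f where "\<And>i. i < n \<Longrightarrow> f i < m" using hm by (auto simp: has_matching_def)
    then have m: "0 < m" using n by (metis gr_zeroI less_nat_zero_code less_le_trans zero_less_one)
    have "?opt \<le> (21 / 8) ^ n * ?out"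
    proof (rule prod_items_value_le[OF _ _ refl m n A(2) val_nonneg])
      show "auction_inv n m (val v) (40 * int m) (prices s) (owners s)" using inv by (simp add: inv_def)
      show "40 * int m \<le> sum (prices s) (items_of m (owners s) h)" if "h < n" for h
        using inv that \<open>i = n\<close> by (simp add: inv_def)
    qed
    then have "root n ?opt \<le> root n ((21 / 8) ^ n * ?out)" using n by (intro real_root_le_mono) auto
    also have "\<dots> = 21 / 8 * root n ?out" using n by (simp add: real_root_mult real_root_power_cancel)
    finally show ?thesis .
  qed
  also have "\<dots> \<le> exp 1 * root n ?out"
    using exp_one_ge n nonneg by (intro mult_right_mono) auto
  finally show ?thesis unfolding opt out by (simp add: divide_simps mult.commute)
qed

section \<open>Total running time\<close>

text \<open>The step bounds of scan, auction and output, with \<open>n\<close>, \<open>m\<close> and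
  \<open>S\<close> all replaced by the input size.\<close>

definition step_bound :: "nat \<Rightarrow> nat" where
  "step_bound x = (7 * (x * x + x) + 1) +
     ((6 * x + 20) * ((x * (6 * (6 + x * (2 * x + 2))) + 1) * (x + 1) + x) + 1 + (5 * x + 3) + 1) + 1 + 2"

lemma exec_nsw_cmd:
  assumes inst: "nsw_instance n m v"
  shows "\<exists>k s'. exec nsw_cmd (input_state n m v) k s' \<and> k \<le> step_bound (input_size n m v) \<and>
    is_allocation n m (output_of m s') \<and> 1 / exp 1 * opt_nsw n m v \<le> nsw n m v (output_of m s')"
proof -
  let ?N = "input_size n m v"
  let ?s0 = "update (input_state n m v) ''d'' 0 1"
  have "scan_inv n m v ?s0"
    unfolding scan_inv_def
    by (auto simp: has_inputs_def update_def input_state_def Let_def fun_eq_iff intro!: exI[of _ 0])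
  moreover have "?s0 ''k'' 0 = 0" "?s0 ''e'' 0 = 0" by (simp_all add: update_def input_state_def)
  ultimately obtain k1 s1 S where scan: "exec scan_cmd ?s0 k1 s1" "k1 \<le> 7 * (n * m + ?N) + 1"
    and inp: "has_inputs n m v s1" and zero: "\<forall>x\<in>{''p'', ''o'', ''s'', ''i'', ''c'', ''x''}. s1 x = (\<lambda>_. 0)"
    and S: "S \<le> ?N" "s1 ''e'' 0 = int S"
      "\<forall>i<n. \<forall>j<m. fst (quotient_of (v i j)) < 2 ^ S \<and> snd (quotient_of (v i j)) < 2 ^ S"
    using exec_scan_cmd by blast
  interpret auction n m v S using inst S(3) by unfold_locales blast+
  have n: "1 \<le> n" using inst by (simp add: nsw_instance_def)
  have pz: "prices s1 = (\<lambda>_. 0)" "owners s1 = (\<lambda>_. 0)" using zero by (auto simp: prices_def owners_def)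
  have "auction_inv n m (val v) (40 * int m) (prices s1) (owners s1)"
    using n by (auto simp: auction_inv_def pz)
  moreover have "bid_count m (max_bids m S) (prices s1) 0"
    unfolding bid_count_def pz by (intro exI[of _ "\<lambda>_. 0"]) simp
  ultimately have "inv 0 0 s1"
    unfolding inv_def using inp S(2) zero by (simp add: pz)
  from exec_auction_cmd[OF this] obtain k2 s2 i where auct: "exec auction_cmd s1 k2 s2"
    "k2 \<le> (6 * m + 20) * ((m * max_bids m S + 1) * (n + 1) + n) + 1"
    and inv: "inv i (nat (s2 ''c'' 0)) s2" and i: "has_matching n m (val v) \<longrightarrow> i = n" by blast
  have "has_inputs n m v s2" "s2 ''x'' = (\<lambda>_. 0)" "\<And>j. j < m \<Longrightarrow> 0 \<le> s2 ''o'' (int j)"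
    using inv by (auto simp: inv_def)
  from exec_output_cmd[OF this] obtain k3 s3 where outp: "exec output_cmd s2 k3 s3" "k3 \<le> 5 * m + 3"
    and x: "\<And>i j. i < n \<Longrightarrow> j < m \<Longrightarrow> output_of m s3 i j = (if owners s2 j = i then 1 else 0)" by blast
  have "exec nsw_cmd (input_state n m v) (k1 + (k2 + k3 + 1) + 1 + 2) s3"
    unfolding nsw_cmd_def using scan(1) exec_Seq[OF _ exec_Seq[OF auct(1) outp(1)]]
    by (intro exec_Assign_Seq) simp
  moreover have "k1 + (k2 + k3 + 1) + 1 + 2 \<le> step_bound ?N"
  proof -
    have le: "n \<le> ?N" "m \<le> ?N" by (auto simp: input_size_def)
    have "k1 \<le> 7 * (?N * ?N + ?N) + 1"
      using scan(2) by (rule order_trans) (use le in \<open>intro add_mono mult_mono; simp\<close>)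
    moreover have "k2 \<le> (6 * ?N + 20) * ((?N * (6 * (6 + ?N * (2 * ?N + 2))) + 1) * (?N + 1) + ?N) + 1"
      using auct(2) unfolding max_bids_def
      by (rule order_trans) (use le S(1) in \<open>intro add_mono mult_mono; simp\<close>)
    moreover have "k3 \<le> 5 * ?N + 3" using outp(2) le by simp
    ultimately show ?thesis unfolding step_bound_def by linarith
  qed
  moreover have "is_allocation n m (output_of m s3)"
    using x inv by (intro is_allocation_owners[where A = "owners s2"]) (auto simp: inv_def auction_inv_def)
  moreover have "1 / exp 1 * opt_nsw n m v \<le> nsw n m v (output_of m s3)"
    by (rule nsw_ge[OF inv i x])
  ultimately show ?thesis by blast
qed

definition is_polynomial :: "(nat \<Rightarrow> nat) \<Rightarrow> bool" where
  "is_polynomial f \<longleftrightarrow> (\<exists>p. \<forall>x. poly p x = f x)"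

lemma is_polynomial_intros:
  "is_polynomial (\<lambda>x. x)" "is_polynomial (\<lambda>x. k)"
  "is_polynomial f \<Longrightarrow> is_polynomial g \<Longrightarrow> is_polynomial (\<lambda>x. f x + g x)"
  "is_polynomial f \<Longrightarrow> is_polynomial g \<Longrightarrow> is_polynomial (\<lambda>x. f x * g x)"
proof -
  show "is_polynomial (\<lambda>x. x)" unfolding is_polynomial_def by (intro exI[of _ "[:0, 1:]"]) simp
  show "is_polynomial (\<lambda>x. k)" unfolding is_polynomial_def by (intro exI[of _ "[:k:]"]) simp
  show "is_polynomial (\<lambda>x. f x + g x)" if "is_polynomial f" "is_polynomial g"
    using that unfolding is_polynomial_def by (metis poly_add)
  show "is_polynomial (\<lambda>x. f x * g x)" if "is_polynomial f" "is_polynomial g"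
    using that unfolding is_polynomial_def by (metis poly_mult)
qed

theorem theorem1p1:
  "\<forall>c::nat. \<exists>(P::com) (p::nat poly). \<forall>(n::nat) (m::nat) (v::nat \<Rightarrow> nat \<Rightarrow> rat).
     nsw_instance n m v \<longrightarrow>
       (let T = poly p (input_size n m v); s = input_state n m v in
          halts_within T P s \<and>
          measure_pmf.prob (run T P s)
            {(d, s', t). is_allocation n m (output_of m s') \<and>
                         nsw n m v (output_of m s') \<ge> 1 / exp 1 * opt_nsw n m v}
          \<ge> 1 - 1 / real (input_size n m v) ^ c)"
proof -
  \<comment> \<open>This is the bound of \<open>run_if_exec\<close> for \<open>z = 500\<close>,
    numbers of \<open>x\<close> bits at the start, and \<open>step_bound x\<close> steps.\<close>
  have "is_polynomial (\<lambda>x. step_bound x * (500 * (500 * (x + step_bound x * 500 + 1) + 1) + 1))"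
    unfolding step_bound_def by (intro is_polynomial_intros)
  then obtain p where
    p: "\<And>x. poly p x = step_bound x * (500 * (500 * (x + step_bound x * 500 + 1) + 1) + 1)"
    unfolding is_polynomial_def by blast
  show ?thesis
  \<comment> \<open>The outcome is certain, so the same program and polynomial serve every
    \<open>c\<close>.\<close>
  proof (intro allI exI[of _ nsw_cmd] exI[of _ p] impI)
    fix c n m :: nat and v :: "nat \<Rightarrow> nat \<Rightarrow> rat"
    assume inst: "nsw_instance n m v"
    let ?T = "poly p (input_size n m v)" and ?s = "input_state n m v"
    obtain k s' where ex: "exec nsw_cmd ?s k s'" "k \<le> step_bound (input_size n m v)"
      and good: "is_allocation n m (output_of m s')" "1 / exp 1 * opt_nsw n m v \<le> nsw n m v (output_of m s')"
      using exec_nsw_cmd[OF inst] by blast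
    obtain t where t: "t \<le> ?T" "run ?T nsw_cmd ?s = return_pmf (Skip, s', t)"
      using run_if_exec[OF ex(1) additive_com_nsw_cmd bounded_input_state ex(2)] p by (metis order_refl)
    show "let T = ?T; s = ?s in halts_within T nsw_cmd s \<and>
          measure_pmf.prob (run T nsw_cmd s)
            {(d, s', t). is_allocation n m (output_of m s') \<and>
                         nsw n m v (output_of m s') \<ge> 1 / exp 1 * opt_nsw n m v}
          \<ge> 1 - 1 / real (input_size n m v) ^ c"
      using t good by (simp add: Let_def halts_within_def)
  qed
qed

end
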